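(* Let $F$ be a locally compact separable metric space, and let $X=\{X_t\}_{t\ge0}$ be a Markov process with values in $F$ that admits a positive Radon symmetrizing measure $m$, with transition operators $\{P_t\}_{t\ge0}$ and generator $\mathscr{L}$. If $u$ denotes the weak solution to the stochastic heat equation $\partial_tu(t,x)=(\mathscr{L}u)(t,x)+\dot w(t,x)$, $u(0,x)=0$ ($t\ge0$, $x\in F$), and $Z$ denotes the occupation measure of $X$, then for all $\phi\in L^2(m)$ and $t\ge0$, $$\tfrac18\,t\,\mathrm{E}\big(|u(t,\phi)|^2\big)\le\mathrm{E}_m\big(|Z(t,\phi)|^2\big)\le4t\,\mathrm{E}\big(|u(t,\phi)|^2\big).$$
   Context: Symmetrizing measure: $(P_tf,g)=(f,P_tg)$ for all $t\ge0$ and $f,g\in L^2(m)$, where $(\phi_1,\phi_2):=\int\phi_1\phi_2\,dm$. The process $X$ is defined, with values in $F$, for all times $t\ge0$ (no killing). $\mathrm{E}_m:=\int_F\mathrm{E}_x(\cdot)\,m(dx)$ is the expectation operator for $X$ started according to the (possibly infinite) measure $m$. Occupation measure: $Z(t,\phi):=\int_0^t\phi(X_s)\,ds$. The noise $w$ is a Gaussian (white-noise) martingale measure on $\mathbf{R}_+\times F$ with Wiener integrals satisfying $\mathrm{E}\big(\int f\,dw\cdot\int g\,dw\big)=\int_0^\infty\int_Ff(s,x)g(s,x)\,m(dx)\,ds$ for $f,g\in L^2(ds\times m)$. The weak solution is $u(t,\phi):=\int_0^t\int_F(P_{t-s}\phi)(x)\,w(dx\,ds)$ for $\phi\in L^2(m)$,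 $t\ge0$. *)

theory Defs
  imports "HOL-Probability.Probability"
begin

text \<open>
  The state space is a type of class metric_space and second_countable_topology (for metric spaces,
  second countability is separability). Time is real, and every time index below is guarded to be
  nonnegative.
\<close>

subsection \<open>Measures and function spaces on the state space\<close>

definition radon_measure :: "'a::topological_space measure \<Rightarrow> bool" where
  "radon_measure m \<longleftrightarrow>
     sets m = sets borel \<and>
     (\<forall>K. compact K \<longrightarrow> emeasure m K < \<infinity>) \<and>
     (\<forall>A\<in>sets borel. emeasure m A = (INF U\<in>{U. open U \<and> A \<subseteq> U}. emeasure m U)) \<and>
     (\<forall>U. open U \<longrightarrow> emeasure m U = (SUP K\<in>{K. compact K \<and> K \<subseteq> U}. emeasure m K))"

text \<open>Elements of \<open>L2 m\<close> are functions, not equivalence classes.\<close>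

definition L2 :: "'b measure \<Rightarrow> ('b \<Rightarrow> real) set" where
  "L2 m = {f \<in> borel_measurable m. integrable m (\<lambda>x. (f x)\<^sup>2)}"

subsection \<open>Markov processes\<close>

text \<open>
  A process on the measurable space \<open>\<Omega>\<close> (only the sigma-algebra of \<open>\<Omega>\<close> matters), with one law
  \<open>P x\<close> on \<open>\<Omega>\<close> for each starting point \<open>x\<close>.
\<close>

definition transition ::
    "('a \<Rightarrow> 'w measure) \<Rightarrow> (real \<Rightarrow> 'w \<Rightarrow> 'a) \<Rightarrow> real \<Rightarrow> ('a \<Rightarrow> real) \<Rightarrow> 'a \<Rightarrow> real" where
  "transition P X t f x = (\<integral>\<omega>. f (X t \<omega>) \<partial>P x)"

definition natural_filtration ::
    "'w measure \<Rightarrow> (real \<Rightarrow> 'w \<Rightarrow> 'a::topological_space) \<Rightarrow> real \<Rightarrow> 'w measure" where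
  "natural_filtration \<Omega> X s =
     sigma (space \<Omega>) {X r -` B \<inter> space \<Omega> | r B. r \<in> {0..s} \<and> B \<in> sets borel}"

text \<open>
  Joint measurability in time and chance is what gives a meaning to the occupation measure; it
  holds for instance for right-continuous paths. The paths stay in the state space for all times,
  i.e. there is no killing.
\<close>

locale markov_process =
  fixes \<Omega> :: "'w measure"
    and P :: "'a::{metric_space, second_countable_topology} \<Rightarrow> 'w measure"
    and X :: "real \<Rightarrow> 'w \<Rightarrow> 'a"
  assumes kernel: "P \<in> borel \<rightarrow>\<^sub>M prob_algebra \<Omega>"
    and measurable_process:
      "(\<lambda>(t, \<omega>). X t \<omega>) \<in> (restrict_space borel {0..} \<Otimes>\<^sub>M \<Omega>) \<rightarrow>\<^sub>M borel"
    and start: "AE \<omega> in P x. X 0 \<omega> = x"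
    and markov_property:
      "\<lbrakk>0 \<le> s; 0 \<le> t; f \<in> borel_measurable borel; bounded (range f)\<rbrakk> \<Longrightarrow>
        AE \<omega> in P x. real_cond_exp (P x) (natural_filtration \<Omega> X s) (\<lambda>\<omega>. f (X (s + t) \<omega>)) \<omega>
          = transition P X t f (X s \<omega>)"

definition symmetrizing ::
    "('a \<Rightarrow> 'w measure) \<Rightarrow> (real \<Rightarrow> 'w \<Rightarrow> 'a) \<Rightarrow> 'a measure \<Rightarrow> bool" where
  "symmetrizing P X m \<longleftrightarrow>
     (\<forall>t\<ge>0. \<forall>f\<in>L2 m. \<forall>g\<in>L2 m.
        (\<integral>x. transition P X t f x * g x \<partial>m) = (\<integral>x. f x * transition P X t g x \<partial>m))"

text \<open>
  Expectation of a nonnegative random variable for the process started from \<open>m\<close>. As \<open>m\<close> may be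
  infinite, it is extended-valued.
\<close>

definition expectation_from ::
    "('a \<Rightarrow> 'w measure) \<Rightarrow> 'a measure \<Rightarrow> ('w \<Rightarrow> ennreal) \<Rightarrow> ennreal" where
  "expectation_from P m Y = (\<integral>\<^sup>+x. (\<integral>\<^sup>+\<omega>. Y \<omega> \<partial>P x) \<partial>m)"

definition occupation :: "(real \<Rightarrow> 'w \<Rightarrow> 'a) \<Rightarrow> real \<Rightarrow> ('a \<Rightarrow> real) \<Rightarrow> 'w \<Rightarrow> real" where
  "occupation X t \<phi> \<omega> = (LBINT s:{0..t}. \<phi> (X s \<omega>))"

subsection \<open>White noise and Wiener integrals\<close>

text \<open>Variance 0 is allowed; \<open>normal_density\<close> itself is meaningful only for positive deviation.\<close>

definition centered_normal :: "'v measure \<Rightarrow> ('v \<Rightarrow> real) \<Rightarrow> bool" where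
  "centered_normal N Y \<longleftrightarrow>
     Y \<in> borel_measurable N \<and>
     ((AE \<omega> in N. Y \<omega> = 0) \<or> (\<exists>\<sigma>>0. distributed N lborel Y (normal_density 0 \<sigma>)))"

text \<open>
  White noise with intensity \<open>\<nu>\<close>: a centered Gaussian process (all finite linear combinations are
  normal) indexed by the sets of finite \<open>\<nu>\<close>-measure, with covariance \<open>\<nu> (A \<inter> B)\<close>. For \<open>\<nu>\<close> the
  space-time measure below, \<open>t \<mapsto> w ({0..t} \<times> A)\<close> is the associated martingale measure.
\<close>

locale white_noise = prob_space N for N :: "'v measure" +
  fixes \<nu> :: "'b measure"
    and w :: "'b set \<Rightarrow> 'v \<Rightarrow> real"
  assumes gaussian:
      "\<lbrakk>finite S; S \<subseteq> {A \<in> sets \<nu>. emeasure \<nu> A < \<infinity>}\<rbrakk> \<Longrightarrow>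
        centered_normal N (\<lambda>\<omega>. \<Sum>A\<in>S. c A * w A \<omega>)"
    and covariance:
      "\<lbrakk>A \<in> sets \<nu>; emeasure \<nu> A < \<infinity>; B \<in> sets \<nu>; emeasure \<nu> B < \<infinity>\<rbrakk> \<Longrightarrow>
        (\<integral>\<omega>. w A \<omega> * w B \<omega> \<partial>N) = measure \<nu> (A \<inter> B)"

definition simple_wiener_integral ::
    "'b measure \<Rightarrow> ('b set \<Rightarrow> 'v \<Rightarrow> real) \<Rightarrow> ('b \<Rightarrow> real) \<Rightarrow> 'v \<Rightarrow> real" where
  "simple_wiener_integral \<nu> w f \<omega> =
     (\<Sum>y\<in>f ` space \<nu> - {0}. y * w (f -` {y} \<inter> space \<nu>) \<omega>)"

text \<open>
  The Wiener integral is the \<open>L\<^sup>2\<close>-continuous extension of \<open>simple_wiener_integral\<close> from simple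
  functions with support of finite measure. It is determined only up to null sets, whence the
  choice of a version.
\<close>

definition has_wiener_integral ::
    "'v measure \<Rightarrow> 'b measure \<Rightarrow> ('b set \<Rightarrow> 'v \<Rightarrow> real) \<Rightarrow> ('b \<Rightarrow> real) \<Rightarrow> ('v \<Rightarrow> real) \<Rightarrow> bool" where
  "has_wiener_integral N \<nu> w f I \<longleftrightarrow>
     f \<in> L2 \<nu> \<and> I \<in> L2 N \<and>
     (\<exists>s. (\<forall>n. Bochner_Integration.simple_bochner_integrable \<nu> (s n)) \<and>
        (\<lambda>n. \<integral>\<^sup>+z. ennreal ((s n z - f z)\<^sup>2) \<partial>\<nu>) \<longlonglongrightarrow> 0 \<and>
        (\<lambda>n. \<integral>\<^sup>+\<omega>. ennreal ((simple_wiener_integral \<nu> w (s n) \<omega> - I \<omega>)\<^sup>2) \<partial>N) \<longlonglongrightarrow> 0)"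

definition wiener_integral ::
    "'v measure \<Rightarrow> 'b measure \<Rightarrow> ('b set \<Rightarrow> 'v \<Rightarrow> real) \<Rightarrow> ('b \<Rightarrow> real) \<Rightarrow> 'v \<Rightarrow> real" where
  "wiener_integral N \<nu> w f = (SOME I. has_wiener_integral N \<nu> w f I)"

subsection \<open>The stochastic heat equation\<close>

definition space_time :: "'a measure \<Rightarrow> (real \<times> 'a) measure" where
  "space_time m = restrict_space lborel {0..} \<Otimes>\<^sub>M m"

text \<open>
  Weak solution, with zero initial condition, of the stochastic heat equation driven by \<open>w\<close> for the
  generator of \<open>X\<close>. The generator enters only through its semigroup \<open>transition P X\<close>.
\<close>

definition weak_solution ::
    "('a \<Rightarrow> 'w measure) \<Rightarrow> (real \<Rightarrow> 'w \<Rightarrow> 'a) \<Rightarrow> 'a measure \<Rightarrow>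
     'v measure \<Rightarrow> ((real \<times> 'a) set \<Rightarrow> 'v \<Rightarrow> real) \<Rightarrow> real \<Rightarrow> ('a \<Rightarrow> real) \<Rightarrow> 'v \<Rightarrow> real" where
  "weak_solution P X m N w t \<phi> =
     wiener_integral N (space_time m) w
       (\<lambda>(s, x). indicator {0..t} s * transition P X (t - s) \<phi> x)"

end

theory Submission
  imports Defs
begin

text \<open>
  Under \<open>E\<^sub>m\<close> the process is stationary, and the Markov property and symmetry give
  \<open>E\<^sub>m (f (X\<^sub>r) f (X\<^sub>s)) = (f, P\<^bsub>|s-r|\<^esub> f) = H (|s - r| / 2)\<close>, where \<open>H v = (P\<^sub>v f, P\<^sub>v f)\<close> is
  nonincreasing. So the second moment of the occupation measure is the integral of \<open>H (|s - r| / 2)\<close>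
  over the square of side \<open>t\<close>, whereas that of the weak solution is the integral of \<open>H\<close> over
  \<open>[0, t]\<close>, by the Wiener isometry. For fixed \<open>s\<close> the integral over \<open>r\<close> is at most four times the
  latter; as one of \<open>[0, s]\<close> and \<open>[s, t]\<close> has length at least \<open>t / 2\<close>, monotonicity of \<open>H\<close> shows
  that it is at least one half of it.
\<close>

subsection \<open>Square-integrable functions\<close>

text \<open>The Markov property is assumed for bounded functions only, while \<phi> is merely
  square-integrable. So the semigroup law and the correlation formula are first proved for bounded
  functions and then carried over from truncations by dominated convergence. As the measure may be
  infinite, the constant 1 need not be square-integrable, and stationarity cannot be read off by
  pairing with it. It is obtained by exhausting the space with sets of finite measure, using that
  paths are never killed. Monotonicity of \<open>H\<close> needs no spectral theorem: Jensen and
  stationarity make every transition operator a contraction, and the semigroup law does the rest. On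
  the noise side the Wiener integral is a chosen object, so existence, by completeness of the
  square-integrable functions, precedes the isometry. Squared norms stay in \<open>ennreal\<close>
  and no square root of an integral is taken; a weighted inequality replaces the triangle
  inequality.\<close>

lemma square_le_weighted_squares:
  fixes x y c :: real
  assumes "c > 0"
  shows "x\<^sup>2 \<le> (1 + c) * y\<^sup>2 + (1 + 1 / c) * (y - x)\<^sup>2"
proof -
  have "0 \<le> (c * y + (y - x))\<^sup>2 / c" using assms by simp
  also have "\<dots> = (1 + c) * y\<^sup>2 + (1 + 1 / c) * (y - x)\<^sup>2 - x\<^sup>2"
    using assms by (simp add: field_simps power2_eq_square)
  finally show ?thesis by simp
qed

text \<open>Stands in for the triangle inequality between squared norms, infinite values included.
  The weight \<open>c = 1\<close> is enough for finiteness; letting \<open>c\<close> tend to 0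
  recovers the sharp constant 1 in front of the norm of \<open>g\<close>.\<close>

lemma nn_integral_square_weighted:
  fixes f g :: "'a \<Rightarrow> real"
  assumes [measurable]: "f \<in> borel_measurable M" "g \<in> borel_measurable M" and c: "c > 0"
  shows "(\<integral>\<^sup>+x. ennreal ((f x)\<^sup>2) \<partial>M) \<le>
    ennreal (1 + c) * (\<integral>\<^sup>+x. ennreal ((g x)\<^sup>2) \<partial>M)
      + ennreal (1 + 1 / c) * (\<integral>\<^sup>+x. ennreal ((g x - f x)\<^sup>2) \<partial>M)"
proof -
  have "(\<integral>\<^sup>+x. ennreal ((f x)\<^sup>2) \<partial>M) \<le>
    (\<integral>\<^sup>+x. ennreal (1 + c) * ennreal ((g x)\<^sup>2) + ennreal (1 + 1 / c) * ennreal ((g x - f x)\<^sup>2) \<partial>M)"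
    using c by (intro nn_integral_mono)
      (simp add: square_le_weighted_squares flip: ennreal_mult ennreal_plus)
  also have "\<dots> = ennreal (1 + c) * (\<integral>\<^sup>+x. ennreal ((g x)\<^sup>2) \<partial>M)
      + ennreal (1 + 1 / c) * (\<integral>\<^sup>+x. ennreal ((g x - f x)\<^sup>2) \<partial>M)"
    by (simp add: nn_integral_add nn_integral_cmult)
  finally show ?thesis .
qed

text \<open>The weighted inequality is used twice, from \<open>f\<close> to \<open>a n\<close> and
  from \<open>b n\<close> to \<open>g\<close>. The error terms vanish as \<open>n\<close> grows,
  leaving the factor \<open>(1 + c)\<close> squared, and then \<open>c\<close> tends to 0. The two
  sequences live on different spaces so that the lemma can compare noise with space-time; swapping
  the roles gives the reverse inequality.\<close>

lemma L2_limit_norm_le: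
  fixes a :: "nat \<Rightarrow> 'a \<Rightarrow> real" and b :: "nat \<Rightarrow> 'b \<Rightarrow> real"
  assumes [measurable]: "\<And>n. a n \<in> borel_measurable M" "\<And>n. b n \<in> borel_measurable N"
      "f \<in> borel_measurable M" "g \<in> borel_measurable N"
    and af: "(\<lambda>n. \<integral>\<^sup>+x. ennreal ((a n x - f x)\<^sup>2) \<partial>M) \<longlonglongrightarrow> 0"
    and bg: "(\<lambda>n. \<integral>\<^sup>+x. ennreal ((b n x - g x)\<^sup>2) \<partial>N) \<longlonglongrightarrow> 0"
    and ab: "\<And>n. (\<integral>\<^sup>+x. ennreal ((a n x)\<^sup>2) \<partial>M) = (\<integral>\<^sup>+x. ennreal ((b n x)\<^sup>2) \<partial>N)"
  shows "(\<integral>\<^sup>+x. ennreal ((f x)\<^sup>2) \<partial>M) \<le> (\<integral>\<^sup>+x. ennreal ((g x)\<^sup>2) \<partial>N)" (is "?F \<le> ?G")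
proof -
  have *: "?F \<le> ennreal (1 + c) * (ennreal (1 + c) * ?G)" if c: "c > 0" for c :: real
  proof -
    let ?A = "\<lambda>n. \<integral>\<^sup>+x. ennreal ((a n x - f x)\<^sup>2) \<partial>M"
    let ?B = "\<lambda>n. \<integral>\<^sup>+x. ennreal ((b n x - g x)\<^sup>2) \<partial>N"
    have "?F \<le> ennreal (1 + c) * (ennreal (1 + c) * ?G + ennreal (1 + 1 / c) * ?B n)
        + ennreal (1 + 1 / c) * ?A n" for n
    proof -
      have "(\<integral>\<^sup>+x. ennreal ((b n x)\<^sup>2) \<partial>N) \<le> ennreal (1 + c) * ?G + ennreal (1 + 1 / c) * ?B n"
        using nn_integral_square_weighted[OF _ _ c, of "b n" N g]
        by (simp add: power2_commute)
      moreover have "?F \<le> ennreal (1 + c) * (\<integral>\<^sup>+x. ennreal ((b n x)\<^sup>2) \<partial>N) + ennreal (1 + 1 / c) * ?A n"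
        using nn_integral_square_weighted[OF _ _ c, of f M "a n"] unfolding ab by simp
      ultimately show ?thesis
        by (elim order_trans) (intro add_right_mono mult_left_mono; simp)
    qed
    moreover have "(\<lambda>n. ennreal (1 + c) * (ennreal (1 + c) * ?G + ennreal (1 + 1 / c) * ?B n)
        + ennreal (1 + 1 / c) * ?A n)
      \<longlonglongrightarrow> ennreal (1 + c) * (ennreal (1 + c) * ?G + ennreal (1 + 1 / c) * 0) + ennreal (1 + 1 / c) * 0"
      by (intro tendsto_intros ennreal_tendsto_cmult af bg) auto
    ultimately have "?F \<le> ennreal (1 + c) * (ennreal (1 + c) * ?G + ennreal (1 + 1 / c) * 0)
        + ennreal (1 + 1 / c) * 0"
      by (intro LIMSEQ_le_const) auto
    then show ?thesis by simp
  qed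
  have "?F \<le> ennreal ((1 + inverse (Suc n)) * (1 + inverse (Suc n))) * ?G" for n
    using *[of "inverse (Suc n)"] by (simp add: ennreal_mult mult.assoc)
  \<comment> \<open>The limiting factor is 1 and not 0, so the product converges even when
    \<open>?G\<close> is infinite.\<close>
  moreover have "(\<lambda>n. ennreal ((1 + inverse (Suc n)) * (1 + inverse (Suc n))) * ?G)
      \<longlonglongrightarrow> ennreal ((1 + 0) * (1 + 0)) * ?G"
    by (intro tendsto_mult_ennreal tendsto_intros tendsto_ennrealI LIMSEQ_inverse_real_of_nat) auto
  ultimately have "?F \<le> ennreal ((1 + 0) * (1 + 0)) * ?G"
    by (intro LIMSEQ_le_const) auto
  then show ?thesis by simp
qed

lemma L2_D:
  assumes "f \<in> L2 M"
  shows "f \<in> borel_measurable M" "integrable M (\<lambda>x. (f x)\<^sup>2)"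
  using assms by (auto simp: L2_def)

lemma L2_iff:
  "f \<in> L2 M \<longleftrightarrow> f \<in> borel_measurable M \<and> (\<integral>\<^sup>+x. ennreal ((f x)\<^sup>2) \<partial>M) < \<infinity>"
  by (auto simp: L2_def integrable_iff_bounded)

lemma abs_mult_le_sum_squares:
  fixes a b :: real
  shows "\<bar>a * b\<bar> \<le> a\<^sup>2 + b\<^sup>2"
proof -
  have "2 * \<bar>a * b\<bar> \<le> a\<^sup>2 + b\<^sup>2"
    using sum_squares_bound[of "\<bar>a\<bar>" "\<bar>b\<bar>"] by (simp add: abs_mult)
  then show ?thesis using abs_ge_zero[of "a * b"] by linarith
qed

lemma L2_mult_integrable:
  assumes "f \<in> L2 M" "g \<in> L2 M"
  shows "integrable M (\<lambda>x. f x * g x)"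
proof (rule Bochner_Integration.integrable_bound)
  show "integrable M (\<lambda>x. (f x)\<^sup>2 + (g x)\<^sup>2)"
    using assms by (auto simp: L2_def)
  show "AE x in M. norm (f x * g x) \<le> norm ((f x)\<^sup>2 + (g x)\<^sup>2)"
    by (simp add: abs_mult_le_sum_squares)
qed (use assms in \<open>auto simp: L2_def intro: borel_measurable_times\<close>)

lemma L2_closeD:
  assumes g: "g \<in> L2 M" and f[measurable]: "f \<in> borel_measurable M"
    and "(\<integral>\<^sup>+x. ennreal ((g x - f x)\<^sup>2) \<partial>M) < \<infinity>"
  shows "f \<in> L2 M"
proof -
  have "(\<integral>\<^sup>+x. ennreal ((f x)\<^sup>2) \<partial>M) < \<infinity>"
    using nn_integral_square_weighted[OF f, of g 1] g assms(3)
    by (auto simp: L2_iff ennreal_mult_less_top less_top elim!: order.strict_trans1)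
  then show ?thesis by (simp add: L2_iff)
qed

text \<open>The argument of Riesz and Fischer: a fast subsequence converges almost everywhere
  because its increments are dominated by a geometric series, and Fatou's lemma turns the Cauchy
  estimate into closeness to the limit for the whole sequence.\<close>

lemma L2_complete:
  fixes W :: "nat \<Rightarrow> 'a \<Rightarrow> real"
  assumes W: "\<And>n. W n \<in> L2 M"
    and Cauchy: "\<And>e. e > 0 \<Longrightarrow> \<exists>K. \<forall>i\<ge>K. \<forall>j\<ge>K. (\<integral>\<^sup>+x. ennreal ((W i x - W j x)\<^sup>2) \<partial>M) \<le> ennreal e"
  shows "\<exists>f\<in>L2 M. (\<lambda>n. \<integral>\<^sup>+x. ennreal ((W n x - f x)\<^sup>2) \<partial>M) \<longlonglongrightarrow> 0"
proof -
  have [measurable]: "W n \<in> borel_measurable M" for n using W by (auto simp: L2_def)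
  \<comment> \<open>The rate 1/8 leaves room for the weight \<open>4^n\<close> below: the weighted
    squared increments still have integrals at most \<open>(1/2)^n\<close>, while finiteness of
    their sum at a point forces the increments to decay like \<open>(1/2)^n\<close>.\<close>
  have "\<exists>K. \<forall>i\<ge>K. \<forall>j\<ge>K. (\<integral>\<^sup>+x. ennreal ((W i x - W j x)\<^sup>2) \<partial>M) \<le> ennreal ((1/8)^n)" for n :: nat
    by (intro Cauchy) simp
  then obtain K where K: "\<And>n i j. i \<ge> K n \<Longrightarrow> j \<ge> K n \<Longrightarrow>
      (\<integral>\<^sup>+x. ennreal ((W i x - W j x)\<^sup>2) \<partial>M) \<le> ennreal ((1/8)^n)"
    by metis
  \<comment> \<open>Summing all thresholds up to \<open>n\<close> puts both \<open>r n\<close> and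
    \<open>r (Suc n)\<close> beyond \<open>K n\<close>, so consecutive terms can be compared at
    level \<open>n\<close>; the summand \<open>n\<close> makes \<open>r\<close> unbounded.\<close>
  define r where "r n = n + (\<Sum>i\<le>n. K i)" for n
  have rK: "K n \<le> r n" "K n \<le> r (Suc n)" for n
  proof -
    have "K n \<le> (\<Sum>i\<le>n. K i)" by (rule member_le_sum) auto
    then show "K n \<le> r n" "K n \<le> r (Suc n)" by (auto simp: r_def)
  qed
  have r_ge: "n \<le> r n" for n by (simp add: r_def)
  define d where "d n x = W (r n) x - W (r (Suc n)) x" for n x
  have [measurable]: "d n \<in> borel_measurable M" for n unfolding d_def by measurable
  have "(\<integral>\<^sup>+x. (\<Sum>n. ennreal (4^n * (d n x)\<^sup>2)) \<partial>M) = (\<Sum>n. \<integral>\<^sup>+x. ennreal (4^n * (d n x)\<^sup>2) \<partial>M)"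
    by (rule nn_integral_suminf) measurable
  also have "\<dots> \<le> (\<Sum>n. ennreal ((1/2)^n))"
  proof (rule suminf_le)
    fix n
    have "(\<integral>\<^sup>+x. ennreal (4^n * (d n x)\<^sup>2) \<partial>M) = ennreal (4^n) * (\<integral>\<^sup>+x. ennreal ((d n x)\<^sup>2) \<partial>M)"
      by (simp add: ennreal_mult nn_integral_cmult)
    also have "\<dots> \<le> ennreal (4^n) * ennreal ((1/8)^n)"
      unfolding d_def by (intro mult_left_mono K rK) simp
    also have "\<dots> = ennreal (4^n * (1/8)^n)"
      by (simp add: ennreal_mult)
    also have "4^n * (1/8)^n = (1/2 :: real)^n"
      by (simp flip: power_mult_distrib)
    finally show "(\<integral>\<^sup>+x. ennreal (4^n * (d n x)\<^sup>2) \<partial>M) \<le> ennreal ((1/2)^n)" .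
  qed auto
  also have "\<dots> < \<infinity>"
    by (subst suminf_ennreal2) (auto simp: summable_geometric)
  finally have "AE x in M. (\<Sum>n. ennreal (4^n * (d n x)\<^sup>2)) \<noteq> \<infinity>"
    by (intro nn_integral_PInf_AE) auto
  then have conv: "AE x in M. convergent (\<lambda>n. W (r n) x)"
  proof eventually_elim
    case (elim x)
    define C where "C = enn2real (\<Sum>n. ennreal (4^n * (d n x)\<^sup>2))"
    have C: "ennreal C = (\<Sum>n. ennreal (4^n * (d n x)\<^sup>2))" "0 \<le> C"
      unfolding C_def using elim by (simp_all add: ennreal_enn2real_if)
    have "norm (d n x) \<le> sqrt C * (1/2)^n" for n
    proof -
      have "(\<Sum>k\<in>{n}. ennreal (4^k * (d k x)\<^sup>2)) \<le> (\<Sum>k. ennreal (4^k * (d k x)\<^sup>2))"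
        by (rule sum_le_suminf) auto
      then have "ennreal (4^n * (d n x)\<^sup>2) \<le> ennreal C"
        unfolding C(1) by (simp only: sum.insert_remove finite.emptyI sum.empty empty_Diff add_0_right)
      moreover have "(2^n)\<^sup>2 = (4::real)^n"
        by (simp add: power2_eq_square flip: power_mult_distrib)
      ultimately have "(2^n * \<bar>d n x\<bar>)\<^sup>2 \<le> C"
        using C(2) by (simp add: power_mult_distrib)
      then have "2^n * \<bar>d n x\<bar> \<le> sqrt C"
        by (rule real_le_rsqrt)
      then show ?thesis by (simp add: field_simps)
    qed
    note d_bound = this
    have "summable (\<lambda>n. sqrt C * (1/2)^n)"
      by (intro summable_mult summable_geometric) simp
    then have "summable (\<lambda>n. d n x)"
      by (rule summable_comparison_test'[OF _ d_bound])
    then have "(\<lambda>n. \<Sum>i<n. d i x) \<longlonglongrightarrow> (\<Sum>i. d i x)" by (rule summable_LIMSEQ)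
    moreover have "(\<Sum>i<n. d i x) = W (r 0) x - W (r n) x" for n
      by (induction n) (auto simp: d_def)
    ultimately have "(\<lambda>n. W (r 0) x - (W (r 0) x - W (r n) x)) \<longlonglongrightarrow> W (r 0) x - (\<Sum>i. d i x)"
      by (intro tendsto_intros) simp
    then show ?case by (auto simp: convergent_def)
  qed
  define f where "f x = lim (\<lambda>n. W (r n) x)" for x
  have [measurable]: "f \<in> borel_measurable M"
    unfolding f_def by (rule borel_measurable_lim_metric) measurable
  have lim: "AE x in M. (\<lambda>n. W (r n) x) \<longlonglongrightarrow> f x"
    using conv unfolding f_def by eventually_elim (simp add: convergent_LIMSEQ_iff)
  have close: "\<exists>L. \<forall>n\<ge>L. (\<integral>\<^sup>+x. ennreal ((W n x - f x)\<^sup>2) \<partial>M) \<le> ennreal e" if e: "e > 0" for e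
  proof -
    obtain L where L: "\<And>i j. i \<ge> L \<Longrightarrow> j \<ge> L \<Longrightarrow> (\<integral>\<^sup>+x. ennreal ((W i x - W j x)\<^sup>2) \<partial>M) \<le> ennreal e"
      using Cauchy[OF e] by blast
    have "(\<integral>\<^sup>+x. ennreal ((W n x - f x)\<^sup>2) \<partial>M) \<le> ennreal e" if n: "n \<ge> L" for n
    proof -
      have "(\<integral>\<^sup>+x. ennreal ((W n x - f x)\<^sup>2) \<partial>M)
          = (\<integral>\<^sup>+x. liminf (\<lambda>k. ennreal ((W n x - W (r k) x)\<^sup>2)) \<partial>M)"
        by (rule nn_integral_cong_AE, use lim in eventually_elim)
          (intro lim_imp_Liminf[symmetric] tendsto_ennrealI tendsto_intros; simp)
      also have "\<dots> \<le> liminf (\<lambda>k. \<integral>\<^sup>+x. ennreal ((W n x - W (r k) x)\<^sup>2) \<partial>M)"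
        by (rule nn_integral_liminf) measurable
      also have "\<dots> \<le> limsup (\<lambda>k. \<integral>\<^sup>+x. ennreal ((W n x - W (r k) x)\<^sup>2) \<partial>M)"
        by (rule Liminf_le_Limsup) simp
      also have "\<dots> \<le> ennreal e"
        by (rule Limsup_bounded, rule eventually_sequentiallyI[of L])
          (intro L n order_trans[OF _ r_ge])
      finally show ?thesis .
    qed
    then show ?thesis by blast
  qed
  have "f \<in> L2 M"
  proof -
    obtain L where "(\<integral>\<^sup>+x. ennreal ((W L x - f x)\<^sup>2) \<partial>M) \<le> ennreal 1"
      using close[of 1] by auto
    then show ?thesis
      by (intro L2_closeD[OF W[of L]]) (auto elim!: order.strict_trans1)
  qed
  moreover have "(\<lambda>n. \<integral>\<^sup>+x. ennreal ((W n x - f x)\<^sup>2) \<partial>M) \<longlonglongrightarrow> 0"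
  proof (rule tendsto_zero_ennreal)
    fix e :: real assume "0 < e"
    with close[of "e / 2"] obtain L where
      L: "\<And>n. n \<ge> L \<Longrightarrow> (\<integral>\<^sup>+x. ennreal ((W n x - f x)\<^sup>2) \<partial>M) \<le> ennreal (e / 2)" by auto
    moreover have "ennreal (e / 2) < ennreal e" using \<open>0 < e\<close> by (intro ennreal_lessI) auto
    ultimately show "\<forall>\<^sub>F n in sequentially. (\<integral>\<^sup>+x. ennreal ((W n x - f x)\<^sup>2) \<partial>M) < ennreal e"
      by (intro eventually_sequentiallyI[of L]) (auto elim!: order.strict_trans1[rotated])
  qed
  ultimately show ?thesis by blast
qed

text \<open>Supplies bounded functions, to which the Markov property applies. Large values are
  replaced by 0, so at each point the sequence is eventually equal to \<open>f\<close>, and it is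
  dominated by \<open>f\<close>.\<close>

definition trunc :: "('a \<Rightarrow> real) \<Rightarrow> nat \<Rightarrow> 'a \<Rightarrow> real" where
  "trunc f n x = (if \<bar>f x\<bar> \<le> real n then f x else 0)"

lemma abs_trunc_le: "\<bar>trunc f n x\<bar> \<le> \<bar>f x\<bar>" "\<bar>trunc f n x\<bar> \<le> real n"
  by (auto simp: trunc_def)

lemma trunc_tendsto: "(\<lambda>n. trunc f n x) \<longlonglongrightarrow> f x"
proof (rule tendsto_eventually)
  obtain N :: nat where "\<bar>f x\<bar> \<le> real N" using real_arch_simple by blast
  then show "\<forall>\<^sub>F n in sequentially. trunc f n x = f x"
    by (intro eventually_sequentiallyI[of N]) (auto simp: trunc_def)
qed

lemma trunc_measurable[measurable]:
  assumes [measurable]: "f \<in> borel_measurable M"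
  shows "trunc f n \<in> borel_measurable M"
  unfolding trunc_def by measurable

lemma L2_mono:
  assumes f: "f \<in> L2 M" and g: "g \<in> borel_measurable M" and le: "\<And>x. \<bar>g x\<bar> \<le> \<bar>f x\<bar>"
  shows "g \<in> L2 M"
proof -
  have "(\<integral>\<^sup>+x. ennreal ((g x)\<^sup>2) \<partial>M) \<le> (\<integral>\<^sup>+x. ennreal ((f x)\<^sup>2) \<partial>M)"
    using le by (intro nn_integral_mono ennreal_leI) (simp add: abs_le_square_iff)
  then show ?thesis using f g by (auto simp: L2_iff)
qed

subsection \<open>The Wiener integral\<close>

lemma simple_bochner_integrableD:
  fixes f :: "'a \<Rightarrow> real"
  assumes "Bochner_Integration.simple_bochner_integrable M f"
  shows "finite (f ` space M)" "f \<in> borel_measurable M"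
    "y \<noteq> 0 \<Longrightarrow> emeasure M (f -` {y} \<inter> space M) < \<infinity>"
    "f -` {y} \<inter> space M \<in> sets M"
proof -
  from assms have f: "simple_function M f" and fin: "emeasure M {x\<in>space M. f x \<noteq> 0} \<noteq> \<infinity>"
    by (auto elim: Bochner_Integration.simple_bochner_integrable.cases)
  show "finite (f ` space M)" using f by (rule simple_functionD)
  show "f \<in> borel_measurable M" using f by (rule borel_measurable_simple_function)
  show m: "f -` {y} \<inter> space M \<in> sets M" for y using f by (rule simple_functionD)
  assume "y \<noteq> 0"
  moreover have "{x\<in>space M. f x \<noteq> 0} \<in> sets M"
  proof -
    note [measurable] = borel_measurable_simple_function[OF f]
    show ?thesis by measurable
  qed
  ultimately have "emeasure M (f -` {y} \<inter> space M) \<le> emeasure M {x\<in>space M. f x \<noteq> 0}"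
    by (intro emeasure_mono) auto
  with fin show "emeasure M (f -` {y} \<inter> space M) < \<infinity>"
    by (auto simp: less_top)
qed

text \<open>Prepares the isometry: with the covariance in place of the measure of the intersection,
  the same double sum over level sets arises from a product of two simple Wiener integrals. The
  value 0 is left out because its level set may have infinite measure.\<close>

lemma simple_function_mult_integral:
  fixes f g :: "'a \<Rightarrow> real"
  assumes f: "Bochner_Integration.simple_bochner_integrable M f"
    and g: "Bochner_Integration.simple_bochner_integrable M g"
  defines "A \<equiv> \<lambda>f y. f -` {y} \<inter> space M"
  shows "integrable M (\<lambda>x. f x * g x)" (is ?I)
    and "(\<integral>x. f x * g x \<partial>M) =
      (\<Sum>y\<in>f ` space M - {0}. \<Sum>z\<in>g ` space M - {0}. y * z * measure M (A f y \<inter> A g z))" (is ?E)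
proof -
  have fin: "emeasure M (A f y \<inter> A g z) < \<infinity>" "A f y \<inter> A g z \<in> sets M" if "y \<noteq> 0" for y z
    using simple_bochner_integrableD(3,4)[OF f, of y] simple_bochner_integrableD(4)[OF g, of z] that
    unfolding A_def by (auto intro: order.strict_trans1[OF emeasure_mono])
  have single: "h x = (\<Sum>y\<in>h ` space M - {0}. y * indicator (A h y) x)"
    if "x \<in> space M" "finite (h ` space M)" for h :: "'a \<Rightarrow> real" and x
  proof -
    have "(\<Sum>y\<in>h ` space M - {0}. y * indicator (A h y) x) = (\<Sum>y\<in>h ` space M - {0}. if y = h x then y else 0)"
      using that by (intro sum.cong) (auto simp: A_def indicator_def)
    also have "\<dots> = h x" using that by (subst sum.delta) auto
    finally show ?thesis by simp
  qed
  have *: "f x * g x = (\<Sum>y\<in>f ` space M - {0}. \<Sum>z\<in>g ` space M - {0}.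
      (y * z) * indicator (A f y \<inter> A g z) x)" if "x \<in> space M" for x
  proof -
    have "f x * g x = (\<Sum>y\<in>f ` space M - {0}. y * indicator (A f y) x)
        * (\<Sum>z\<in>g ` space M - {0}. z * indicator (A g z) x)"
      by (rule arg_cong2[where f = "(*)"])
        (rule single[OF that simple_bochner_integrableD(1)[OF f]],
          rule single[OF that simple_bochner_integrableD(1)[OF g]])
    then show ?thesis by (simp add: sum_product indicator_inter_arith ac_simps)
  qed
  have int: "integrable M (\<lambda>x. (y * z) * indicator (A f y \<inter> A g z) x)" if "y \<noteq> 0" for y z :: real
    using fin[OF that, of z] by (intro integrable_mult_right integrable_real_indicator)
  have int': "integrable M (indicator (A f y \<inter> A g z) :: _ \<Rightarrow> real)" if "y \<noteq> 0" for y z :: real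
    using fin[OF that, of z] by (intro integrable_real_indicator)
  show ?I
    by (subst Bochner_Integration.integrable_cong[OF refl *], assumption)
      (auto intro!: Bochner_Integration.integrable_sum int int')
  have "(\<integral>x. f x * g x \<partial>M) = (\<integral>x. (\<Sum>y\<in>f ` space M - {0}. \<Sum>z\<in>g ` space M - {0}.
      (y * z) * indicator (A f y \<inter> A g z) x) \<partial>M)"
    by (rule Bochner_Integration.integral_cong[OF refl *])
  also have "\<dots> = (\<Sum>y\<in>f ` space M - {0}. \<Sum>z\<in>g ` space M - {0}. y * z * measure M (A f y \<inter> A g z))"
    using fin(2)
    by (subst Bochner_Integration.integral_sum; (auto intro!: Bochner_Integration.integrable_sum int int')?)
      (intro sum.cong refl, subst Bochner_Integration.integral_sum,
        auto intro!: int int' sum.cong)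
  finally show ?E .
qed

lemma L2_simple_approx:
  assumes f: "f \<in> L2 M"
  shows "\<exists>s. (\<forall>n. Bochner_Integration.simple_bochner_integrable M (s n)) \<and>
    (\<lambda>n. \<integral>\<^sup>+x. ennreal ((s n x - f x)\<^sup>2) \<partial>M) \<longlonglongrightarrow> 0"
proof -
  note [measurable] = L2_D(1)[OF f]
  obtain s where s: "\<And>n. simple_function M (s n)"
    and lim: "\<And>x. x \<in> space M \<Longrightarrow> (\<lambda>n. s n x) \<longlonglongrightarrow> f x"
    and bnd: "\<And>n x. x \<in> space M \<Longrightarrow> norm (s n x) \<le> 2 * norm (f x)"
    using borel_measurable_implies_sequence_metric[OF L2_D(1)[OF f], of 0] by (simp add: dist_norm) blast
  have [measurable]: "s n \<in> borel_measurable M" for n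
    using s by (rule borel_measurable_simple_function)
  have "Bochner_Integration.simple_bochner_integrable M (s n)" for n
  proof (intro Bochner_Integration.simple_bochner_integrable.intros s)
    have fin: "finite (s n ` space M)" using s by (rule simple_functionD)
    \<comment> \<open>The least nonzero squared value of \<open>s n\<close>, for a Chebyshev bound
      on its support. Inserting 1 keeps the minimum defined when \<open>s n\<close> vanishes
      identically.\<close>
    define c where "c = Min (insert 1 ((\<lambda>y. y\<^sup>2) ` (s n ` space M - {0})))"
    have c: "c > 0" unfolding c_def using fin by (subst Min_gr_iff) auto
    have "ennreal c * emeasure M {x\<in>space M. s n x \<noteq> 0} = (\<integral>\<^sup>+x. ennreal c * indicator {x\<in>space M. s n x \<noteq> 0} x \<partial>M)"
      by (rule nn_integral_cmult_indicator[symmetric]) measurable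
    also have "\<dots> \<le> (\<integral>\<^sup>+x. ennreal 4 * ennreal ((f x)\<^sup>2) \<partial>M)"
    proof (rule nn_integral_mono)
      fix x assume x: "x \<in> space M"
      have "c \<le> 4 * (f x)\<^sup>2" if "s n x \<noteq> 0"
      proof -
        have "c \<le> (s n x)\<^sup>2" unfolding c_def using fin x that by (intro Min_le) auto
        also have "\<dots> \<le> (2 * norm (f x))\<^sup>2" using bnd[OF x, of n]
          power_mono[OF bnd[OF x, of n], of 2] by simp
        finally show ?thesis by (simp add: power_mult_distrib)
      qed
      then show "ennreal c * indicator {x\<in>space M. s n x \<noteq> 0} x \<le> ennreal 4 * ennreal ((f x)\<^sup>2)"
        by (subst ennreal_mult[symmetric]) (auto simp: indicator_def intro!: ennreal_leI)
    qed
    also have "\<dots> < \<infinity>"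
      using f by (subst nn_integral_cmult) (auto simp: L2_iff ennreal_mult_less_top)
    finally show "emeasure M {x\<in>space M. s n x \<noteq> 0} \<noteq> \<infinity>"
      using c by (auto simp: ennreal_mult_less_top)
  qed
  moreover have "(\<lambda>n. \<integral>\<^sup>+x. ennreal ((s n x - f x)\<^sup>2) \<partial>M) \<longlonglongrightarrow> (\<integral>\<^sup>+x. 0 \<partial>M)"
  proof (rule nn_integral_dominated_convergence[where w = "\<lambda>x. ennreal (9 * (f x)\<^sup>2)"])
    have "(s n x - f x)\<^sup>2 \<le> 9 * (f x)\<^sup>2" if "x \<in> space M" for n x
    proof -
      have "\<bar>s n x - f x\<bar> \<le> 3 * \<bar>f x\<bar>" using bnd[OF that, of n] by simp
      then have "\<bar>s n x - f x\<bar>\<^sup>2 \<le> (3 * \<bar>f x\<bar>)\<^sup>2" by (rule power_mono) simp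
      then show ?thesis by (simp add: power_mult_distrib)
    qed
    then show "\<And>n. AE x in M. ennreal ((s n x - f x)\<^sup>2) \<le> ennreal (9 * (f x)\<^sup>2)"
      by (auto intro!: AE_I2 ennreal_leI)
    show "(\<integral>\<^sup>+x. ennreal (9 * (f x)\<^sup>2) \<partial>M) < \<infinity>"
      using f by (simp add: ennreal_mult nn_integral_cmult L2_iff ennreal_mult_less_top)
    have "(\<lambda>n. ennreal ((s n x - f x)\<^sup>2)) \<longlonglongrightarrow> ennreal ((f x - f x)\<^sup>2)" if "x \<in> space M" for x
      by (intro tendsto_intros tendsto_ennrealI lim that)
    then show "AE x in M. (\<lambda>n. ennreal ((s n x - f x)\<^sup>2)) \<longlonglongrightarrow> 0"
      by (intro AE_I2) simp
  qed auto
  ultimately show ?thesis by auto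
qed

context white_noise
begin

text \<open>The covariance identity does not yield integrability, since the Bochner integral of a
  non-integrable function is 0 by convention. The normal law of a single \<open>w A\<close> does,
  with the degenerate case treated apart.\<close>

lemma noise_L2:
  assumes A: "A \<in> sets \<nu>" "emeasure \<nu> A < \<infinity>"
  shows "w A \<in> L2 N"
proof -
  have "centered_normal N (\<lambda>\<omega>. \<Sum>A\<in>{A}. 1 * w A \<omega>)"
    using A by (intro gaussian) auto
  then have m[measurable]: "w A \<in> borel_measurable N"
    and "(AE \<omega> in N. w A \<omega> = 0) \<or> (\<exists>\<sigma>>0. distributed N lborel (w A) (normal_density 0 \<sigma>))"
    by (auto simp: centered_normal_def)
  then consider "AE \<omega> in N. w A \<omega> = 0"
    | \<sigma> where "\<sigma> > 0" "distributed N lborel (w A) (normal_density 0 \<sigma>)" by auto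
  then have "integrable N (\<lambda>\<omega>. (w A \<omega>)\<^sup>2)"
  proof cases
    case 1
    then have "integrable N (\<lambda>\<omega>. (w A \<omega>)\<^sup>2) \<longleftrightarrow> integrable N (\<lambda>\<omega>. 0 :: real)"
      by (intro integrable_cong_AE) auto
    then show ?thesis by simp
  next
    case 2
    then show ?thesis
      using integrable_normal_moment[of \<sigma> 0 2]
      by (subst distributed_integrable[OF 2(2), symmetric]) auto
  qed
  then show ?thesis by (simp add: L2_def m)
qed

lemma simple_wiener_integral_mult:
  assumes f: "Bochner_Integration.simple_bochner_integrable \<nu> f"
    and g: "Bochner_Integration.simple_bochner_integrable \<nu> g"
  shows "integrable N (\<lambda>\<omega>. simple_wiener_integral \<nu> w f \<omega> * simple_wiener_integral \<nu> w g \<omega>)" (is ?I)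
    and "(\<integral>\<omega>. simple_wiener_integral \<nu> w f \<omega> * simple_wiener_integral \<nu> w g \<omega> \<partial>N)
      = (\<integral>x. f x * g x \<partial>\<nu>)" (is ?E)
proof -
  let ?A = "\<lambda>f y. f -` {y} \<inter> space \<nu>"
  note D = simple_bochner_integrableD
  have eq: "simple_wiener_integral \<nu> w f \<omega> * simple_wiener_integral \<nu> w g \<omega> =
    (\<Sum>y\<in>f ` space \<nu> - {0}. \<Sum>z\<in>g ` space \<nu> - {0}. (y * z) * (w (?A f y) \<omega> * w (?A g z) \<omega>))" for \<omega>
    by (simp add: simple_wiener_integral_def sum_product ac_simps)
  have int: "integrable N (\<lambda>\<omega>. (y * z) * (w (?A f y) \<omega> * w (?A g z) \<omega>))"
    if "y \<noteq> 0" "z \<noteq> 0" for y z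
    by (intro integrable_mult_right L2_mult_integrable noise_L2 D(3,4)[OF f] D(3,4)[OF g] that)
  show ?I unfolding eq
    by (auto intro!: Bochner_Integration.integrable_sum int)
  have "(\<integral>\<omega>. simple_wiener_integral \<nu> w f \<omega> * simple_wiener_integral \<nu> w g \<omega> \<partial>N) =
    (\<Sum>y\<in>f ` space \<nu> - {0}. \<integral>\<omega>. (\<Sum>z\<in>g ` space \<nu> - {0}. (y * z) * (w (?A f y) \<omega> * w (?A g z) \<omega>)) \<partial>N)"
    unfolding eq by (rule Bochner_Integration.integral_sum) (auto intro!: Bochner_Integration.integrable_sum int)
  also have "\<dots> = (\<Sum>y\<in>f ` space \<nu> - {0}. \<Sum>z\<in>g ` space \<nu> - {0}. \<integral>\<omega>. (y * z) * (w (?A f y) \<omega> * w (?A g z) \<omega>) \<partial>N)"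
    by (intro sum.cong refl Bochner_Integration.integral_sum int) auto
  also have "\<dots> = (\<Sum>y\<in>f ` space \<nu> - {0}. \<Sum>z\<in>g ` space \<nu> - {0}. y * z * measure \<nu> (?A f y \<inter> ?A g z))"
    using D(3,4)[OF f] D(3,4)[OF g]
    by (intro sum.cong refl) (simp add: covariance)
  also have "\<dots> = (\<integral>x. f x * g x \<partial>\<nu>)"
    by (rule simple_function_mult_integral(2)[OF f g, symmetric])
  finally show ?E .
qed

lemma simple_wiener_integral_L2:
  assumes f: "Bochner_Integration.simple_bochner_integrable \<nu> f"
  shows "simple_wiener_integral \<nu> w f \<in> L2 N"
proof -
  have "w (f -` {y} \<inter> space \<nu>) \<in> borel_measurable N" if "y \<noteq> 0" for y
    using noise_L2 simple_bochner_integrableD(3,4)[OF f] that by (auto simp: L2_def)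
  then have "simple_wiener_integral \<nu> w f \<in> borel_measurable N"
    unfolding simple_wiener_integral_def
    by (intro borel_measurable_sum borel_measurable_times borel_measurable_const) auto
  then show ?thesis
    using simple_wiener_integral_mult(1)[OF f f] by (simp add: L2_def power2_eq_square)
qed

text \<open>Expanding the square reduces the claim to the product formula for the three pairs of
  \<open>f\<close> and \<open>g\<close>. This avoids linearity of the simple integral, and with it
  any additivity of \<open>w\<close> on disjoint sets.\<close>

lemma simple_wiener_isometry:
  assumes f: "Bochner_Integration.simple_bochner_integrable \<nu> f"
    and g: "Bochner_Integration.simple_bochner_integrable \<nu> g"
  shows "(\<integral>\<^sup>+\<omega>. ennreal ((simple_wiener_integral \<nu> w f \<omega> - simple_wiener_integral \<nu> w g \<omega>)\<^sup>2) \<partial>N)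
    = (\<integral>\<^sup>+x. ennreal ((f x - g x)\<^sup>2) \<partial>\<nu>)"
proof -
  let ?W = "simple_wiener_integral \<nu> w"
  note W = simple_wiener_integral_mult
  note S = simple_function_mult_integral(1)
  have sq: "(a - b)\<^sup>2 = a * a - 2 * (a * b) + b * b" for a b :: real
    by (simp add: power2_eq_square algebra_simps)
  have intW: "integrable N (\<lambda>\<omega>. (?W f \<omega> - ?W g \<omega>)\<^sup>2)"
    unfolding sq using W(1)[OF f f] W(1)[OF f g] W(1)[OF g g] by auto
  have intS: "integrable \<nu> (\<lambda>x. (f x - g x)\<^sup>2)"
    unfolding sq using S[OF f f] S[OF f g] S[OF g g] by auto
  have "(\<integral>\<^sup>+\<omega>. ennreal ((?W f \<omega> - ?W g \<omega>)\<^sup>2) \<partial>N) = ennreal (\<integral>\<omega>. (?W f \<omega> - ?W g \<omega>)\<^sup>2 \<partial>N)"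
    by (intro nn_integral_eq_integral intW) auto
  also have "(\<integral>\<omega>. (?W f \<omega> - ?W g \<omega>)\<^sup>2 \<partial>N) = (\<integral>x. (f x - g x)\<^sup>2 \<partial>\<nu>)"
    unfolding sq using W[OF f f] W[OF f g] W[OF g g] S[OF f f] S[OF f g] S[OF g g] by simp
  also have "ennreal \<dots> = (\<integral>\<^sup>+x. ennreal ((f x - g x)\<^sup>2) \<partial>\<nu>)"
    by (intro nn_integral_eq_integral[symmetric] intS) auto
  finally show ?thesis .
qed

lemma simple_wiener_norm:
  assumes f: "Bochner_Integration.simple_bochner_integrable \<nu> f"
  shows "(\<integral>\<^sup>+\<omega>. ennreal ((simple_wiener_integral \<nu> w f \<omega>)\<^sup>2) \<partial>N) = (\<integral>\<^sup>+x. ennreal ((f x)\<^sup>2) \<partial>\<nu>)"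
proof -
  have "Bochner_Integration.simple_bochner_integrable \<nu> (\<lambda>_. 0 :: real)"
    by (rule Bochner_Integration.simple_bochner_integrable.intros) auto
  moreover have "simple_wiener_integral \<nu> w (\<lambda>_. 0) \<omega> = 0" for \<omega>
    by (auto simp: simple_wiener_integral_def intro!: sum.neutral)
  ultimately show ?thesis
    using simple_wiener_isometry[OF f, of "\<lambda>_. 0"] by simp
qed

text \<open>Needed because \<open>wiener_integral\<close> is a choice. By the isometry, simple
  approximations of \<open>f\<close> have Cauchy integrals, and completeness supplies the
  limit.\<close>

lemma has_wiener_integral_exists:
  assumes f: "f \<in> L2 \<nu>"
  shows "\<exists>I. has_wiener_integral N \<nu> w f I"
proof -
  obtain s where s: "\<And>n. Bochner_Integration.simple_bochner_integrable \<nu> (s n)"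
    and lim: "(\<lambda>n. \<integral>\<^sup>+x. ennreal ((s n x - f x)\<^sup>2) \<partial>\<nu>) \<longlonglongrightarrow> 0"
    using L2_simple_approx[OF f] by auto
  note [measurable] = L2_D(1)[OF f] simple_bochner_integrableD(2)[OF s]
  let ?W = "\<lambda>n. simple_wiener_integral \<nu> w (s n)"
  have "\<exists>K. \<forall>i\<ge>K. \<forall>j\<ge>K. (\<integral>\<^sup>+\<omega>. ennreal ((?W i \<omega> - ?W j \<omega>)\<^sup>2) \<partial>N) \<le> ennreal e"
    if e: "e > 0" for e
  proof -
    have "0 < ennreal (e / 4)" using e by simp
    from order_tendstoD(2)[OF lim this] obtain K where
      K: "\<And>n. n \<ge> K \<Longrightarrow> (\<integral>\<^sup>+x. ennreal ((s n x - f x)\<^sup>2) \<partial>\<nu>) < ennreal (e / 4)"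
      by (auto simp: eventually_sequentially)
    have "(\<integral>\<^sup>+\<omega>. ennreal ((?W i \<omega> - ?W j \<omega>)\<^sup>2) \<partial>N) \<le> ennreal e" if "i \<ge> K" "j \<ge> K" for i j
    proof -
      have "(\<integral>\<^sup>+\<omega>. ennreal ((?W i \<omega> - ?W j \<omega>)\<^sup>2) \<partial>N) = (\<integral>\<^sup>+x. ennreal ((s i x - s j x)\<^sup>2) \<partial>\<nu>)"
        by (rule simple_wiener_isometry[OF s s])
      \<comment> \<open>The weighted inequality with \<open>c = 1\<close>; the last square is that
        of \<open>s j x - f x\<close>. Both factors are 2, which explains the tolerance
        \<open>e / 4\<close>.\<close>
      also have "\<dots> \<le> ennreal (1 + 1) * (\<integral>\<^sup>+x. ennreal ((s i x - f x)\<^sup>2) \<partial>\<nu>)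
          + ennreal (1 + 1 / 1) * (\<integral>\<^sup>+x. ennreal (((s i x - f x) - (s i x - s j x))\<^sup>2) \<partial>\<nu>)"
        by (rule nn_integral_square_weighted) auto
      also have "\<dots> \<le> ennreal (1 + 1) * ennreal (e / 4) + ennreal (1 + 1 / 1) * ennreal (e / 4)"
        using K[OF that(1)] K[OF that(2)] by (intro add_mono mult_left_mono) auto
      also have "\<dots> = ennreal e"
        using e by (subst (1 2) ennreal_mult[symmetric]) (auto simp flip: ennreal_plus)
      finally show ?thesis .
    qed
    then show ?thesis by blast
  qed
  then obtain I where "I \<in> L2 N" "(\<lambda>n. \<integral>\<^sup>+\<omega>. ennreal ((?W n \<omega> - I \<omega>)\<^sup>2) \<partial>N) \<longlonglongrightarrow> 0"
    using L2_complete[of ?W N, OF simple_wiener_integral_L2[OF s]] by auto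
  then show ?thesis
    using s lim f by (auto simp: has_wiener_integral_def)
qed

text \<open>Holds for every version \<open>I\<close>, so the choice in
  \<open>wiener_integral\<close> is harmless. Each inequality is the limit lemma for the simple
  approximations, in one of the two directions.\<close>

lemma has_wiener_integral_norm:
  assumes "has_wiener_integral N \<nu> w f I"
  shows "(\<integral>\<^sup>+\<omega>. ennreal ((I \<omega>)\<^sup>2) \<partial>N) = (\<integral>\<^sup>+x. ennreal ((f x)\<^sup>2) \<partial>\<nu>)"
proof -
  obtain s where s: "\<And>n. Bochner_Integration.simple_bochner_integrable \<nu> (s n)"
    and lim: "(\<lambda>n. \<integral>\<^sup>+x. ennreal ((s n x - f x)\<^sup>2) \<partial>\<nu>) \<longlonglongrightarrow> 0"
      "(\<lambda>n. \<integral>\<^sup>+\<omega>. ennreal ((simple_wiener_integral \<nu> w (s n) \<omega> - I \<omega>)\<^sup>2) \<partial>N) \<longlonglongrightarrow> 0"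
    and [measurable]: "f \<in> borel_measurable \<nu>" "I \<in> borel_measurable N"
    using assms by (auto simp: has_wiener_integral_def L2_def)
  have [measurable]: "simple_wiener_integral \<nu> w (s n) \<in> borel_measurable N" "s n \<in> borel_measurable \<nu>" for n
    using simple_wiener_integral_L2[OF s] simple_bochner_integrableD(2)[OF s] by (auto simp: L2_def)
  show ?thesis
  proof (rule antisym)
    show "(\<integral>\<^sup>+\<omega>. ennreal ((I \<omega>)\<^sup>2) \<partial>N) \<le> (\<integral>\<^sup>+x. ennreal ((f x)\<^sup>2) \<partial>\<nu>)"
      by (rule L2_limit_norm_le[OF _ _ _ _ lim(2,1)]) (simp_all add: simple_wiener_norm[OF s])
    show "(\<integral>\<^sup>+x. ennreal ((f x)\<^sup>2) \<partial>\<nu>) \<le> (\<integral>\<^sup>+\<omega>. ennreal ((I \<omega>)\<^sup>2) \<partial>N)"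
      by (rule L2_limit_norm_le[OF _ _ _ _ lim]) (simp_all add: simple_wiener_norm[OF s])
  qed
qed

lemma wiener_integral_norm:
  assumes "f \<in> L2 \<nu>"
  shows "(\<integral>\<^sup>+\<omega>. ennreal ((wiener_integral N \<nu> w f \<omega>)\<^sup>2) \<partial>N) = (\<integral>\<^sup>+x. ennreal ((f x)\<^sup>2) \<partial>\<nu>)"
  unfolding wiener_integral_def
  by (rule has_wiener_integral_norm) (rule someI_ex[OF has_wiener_integral_exists[OF assms]])

end

subsection \<open>Symmetric Markov processes\<close>

text \<open>Here the integrand depends on the parameter too. Pushing \<open>L x\<close> forward
  along \<open>y\<close> to \<open>(x, y)\<close> makes the integrand fixed, so that only the
  measure varies.\<close>

lemma integral_measurable_kernel:
  fixes f :: "'a \<Rightarrow> 'b \<Rightarrow> real"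
  assumes f[measurable]: "(\<lambda>(x, y). f x y) \<in> borel_measurable (M \<Otimes>\<^sub>M N)"
  assumes L[measurable]: "L \<in> measurable M (subprob_algebra N)"
  shows "(\<lambda>x. \<integral>y. f x y \<partial>L x) \<in> borel_measurable M"
proof -
  note integral_measurable_subprob_algebra[measurable]
  note measurable_distr2[measurable]
  have "(\<lambda>x. \<integral>z. (case z of (x, y) \<Rightarrow> f x y) \<partial>distr (L x) (M \<Otimes>\<^sub>M N) (\<lambda>y. (x, y))) \<in> borel_measurable M"
    by measurable
  then show ?thesis
    by (rule measurable_cong[THEN iffD1, rotated]) (simp add: integral_distr)
qed

text \<open>Fubini for a signed integrand and a mixing measure that may be infinite: the nonnegative
  formula is applied to the positive and the negative part, whose inner integrals are finite almost
  everywhere.\<close>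

lemma integral_bind_kernel:
  fixes f :: "'b \<Rightarrow> real"
  assumes K[measurable]: "K \<in> M \<rightarrow>\<^sub>M subprob_algebra B"
    and f: "integrable (M \<bind> K) f" and fB[measurable]: "f \<in> borel_measurable B"
  shows "AE x in M. integrable (K x) f"
    and "(\<integral>x. f x \<partial>(M \<bind> K)) = (\<integral>x. \<integral>y. f y \<partial>K x \<partial>M)"
proof -
  have sets_K: "sets (K x) = sets B" if "x \<in> space M" for x
    using K that by (rule subprob_measurableD)
  have fK: "f \<in> borel_measurable (K x)" if "x \<in> space M" for x
    using fB measurable_cong_sets[OF sets_K[OF that] refl] by blast
  have nn: "(\<integral>\<^sup>+x. g x \<partial>(M \<bind> K)) = (\<integral>\<^sup>+x. \<integral>\<^sup>+y. g y \<partial>K x \<partial>M)"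
    if "g \<in> borel_measurable B" for g
    by (rule nn_integral_bind[OF that K])
  let ?p = "\<lambda>x. \<integral>\<^sup>+y. ennreal (f y) \<partial>K x" and ?n = "\<lambda>x. \<integral>\<^sup>+y. ennreal (- f y) \<partial>K x"
  have [measurable]: "?p \<in> borel_measurable M" "?n \<in> borel_measurable M"
    by (intro measurable_compose[OF K] nn_integral_measurable_subprob_algebra; measurable)+
  have fin: "(\<integral>\<^sup>+x. ?p x \<partial>M) < \<infinity>" "(\<integral>\<^sup>+x. ?n x \<partial>M) < \<infinity>"
    using f by (auto simp: real_integrable_def less_top simp flip: nn)
  have AEp: "AE x in M. ?p x \<noteq> \<infinity>" "AE x in M. ?n x \<noteq> \<infinity>"
    by (rule nn_integral_PInf_AE, measurable, rule fin[THEN order.strict_implies_not_eq])+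
  then show int: "AE x in M. integrable (K x) f"
    using AE_space by eventually_elim (auto simp: real_integrable_def fK)
  have enn: "integrable M (\<lambda>x. enn2real (h x)) \<and> (\<integral>x. enn2real (h x) \<partial>M) = enn2real (\<integral>\<^sup>+x. h x \<partial>M)"
    if [measurable]: "h \<in> borel_measurable M" and "(\<integral>\<^sup>+x. h x \<partial>M) < \<infinity>" "AE x in M. h x \<noteq> \<infinity>"
    for h :: "'a \<Rightarrow> ennreal"
  proof -
    have *: "(\<integral>\<^sup>+x. ennreal (enn2real (h x)) \<partial>M) = (\<integral>\<^sup>+x. h x \<partial>M)"
      by (rule nn_integral_cong_AE) (use that(3) in eventually_elim, simp add: ennreal_enn2real_if)
    with that(2) have "integrable M (\<lambda>x. enn2real (h x))"
      by (intro integrableI_nonneg) auto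
    then show ?thesis
      by (subst integral_eq_nn_integral) (auto simp: *)
  qed
  note p = enn[of ?p, OF _ fin(1) AEp(1)] and n = enn[of ?n, OF _ fin(2) AEp(2)]
  have "(\<integral>x. f x \<partial>(M \<bind> K)) = enn2real (\<integral>\<^sup>+x. ?p x \<partial>M) - enn2real (\<integral>\<^sup>+x. ?n x \<partial>M)"
    by (simp add: real_lebesgue_integral_def[OF f] nn)
  also have "\<dots> = (\<integral>x. enn2real (?p x) - enn2real (?n x) \<partial>M)"
    using p n by simp
  also have "\<dots> = (\<integral>x. \<integral>y. f y \<partial>K x \<partial>M)"
  proof (rule integral_cong_AE)
    show "(\<lambda>x. \<integral>y. f y \<partial>K x) \<in> borel_measurable M"
      by (rule measurable_compose[OF K]) (rule integral_measurable_subprob_algebra[OF fB])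
    show "AE x in M. enn2real (?p x) - enn2real (?n x) = (\<integral>y. f y \<partial>K x)"
      using int by eventually_elim (simp add: real_lebesgue_integral_def)
  qed measurable
  finally show "(\<integral>x. f x \<partial>(M \<bind> K)) = (\<integral>x. \<integral>y. f y \<partial>K x \<partial>M)" .
qed

text \<open>Cauchy-Schwarz against the constant 1. If \<open>f\<close> is not integrable, its
  integral is 0 by convention and the bound is trivial.\<close>

lemma (in prob_space) square_integral_le_nn_integral:
  fixes f :: "'a \<Rightarrow> real"
  assumes [measurable]: "f \<in> borel_measurable M"
  shows "ennreal ((\<integral>x. f x \<partial>M)\<^sup>2) \<le> (\<integral>\<^sup>+x. ennreal ((f x)\<^sup>2) \<partial>M)"
proof (cases "integrable M f")
  case True
  have "ennreal \<bar>\<integral>x. f x \<partial>M\<bar> \<le> (\<integral>\<^sup>+x. ennreal \<bar>f x\<bar> \<partial>M)"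
    using integral_norm_bound_ennreal[OF True] by simp
  then have "(ennreal \<bar>\<integral>x. f x \<partial>M\<bar>)\<^sup>2 \<le> (\<integral>\<^sup>+x. ennreal \<bar>f x\<bar> * 1 \<partial>M)\<^sup>2"
    by (intro power_mono) auto
  also have "\<dots> \<le> (\<integral>\<^sup>+x. (ennreal \<bar>f x\<bar>)\<^sup>2 \<partial>M) * (\<integral>\<^sup>+x. 1\<^sup>2 \<partial>M)"
    by (rule Cauchy_Schwarz_nn_integral) auto
  finally show ?thesis
    by (simp add: emeasure_space_1 ennreal_power)
qed (simp add: not_integrable_integral_eq)

section \<open>Integrals over a square of a function of the time difference\<close>

text \<open>For fixed \<open>s\<close>, the substitution \<open>v = \<bar>s - r\<bar> / 2\<close>
  keeps \<open>v\<close> in \<open>{0..t}\<close> and costs a factor 2 on each side of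
  \<open>s\<close>, whence 4.\<close>

lemma nn_integral_abs_diff_upper:
  fixes e :: "real \<Rightarrow> ennreal" and t :: real
  assumes [measurable]: "e \<in> borel_measurable borel" and t: "0 \<le> t"
  shows "(\<integral>\<^sup>+s. \<integral>\<^sup>+r. indicator {0..t} s * indicator {0..t} r * e (\<bar>s - r\<bar> / 2) \<partial>lborel \<partial>lborel)
    \<le> ennreal (4 * t) * (\<integral>\<^sup>+v. indicator {0..t} v * e v \<partial>lborel)"
proof -
  define g where "g v = indicator {0..t} v * e v" for v
  have [measurable]: "g \<in> borel_measurable borel" unfolding g_def by measurable
  have aff: "(\<integral>\<^sup>+r. g ((r - s) / 2) \<partial>lborel) = 2 * (\<integral>\<^sup>+v. g v \<partial>lborel)"
    "(\<integral>\<^sup>+r. g ((s - r) / 2) \<partial>lborel) = 2 * (\<integral>\<^sup>+v. g v \<partial>lborel)" for s :: real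
    using nn_integral_real_affine[of "\<lambda>r. g ((r - s) / 2)" 2 s]
      nn_integral_real_affine[of "\<lambda>r. g ((s - r) / 2)" "-2" s] by simp_all
  have "(\<integral>\<^sup>+r. indicator {0..t} s * indicator {0..t} r * e (\<bar>s - r\<bar> / 2) \<partial>lborel)
      \<le> (4 * (\<integral>\<^sup>+v. g v \<partial>lborel)) * indicator {0..t} s" for s
  proof (cases "s \<in> {0..t}")
    case True
    have "(\<integral>\<^sup>+r. indicator {0..t} s * indicator {0..t} r * e (\<bar>s - r\<bar> / 2) \<partial>lborel)
        \<le> (\<integral>\<^sup>+r. g ((r - s) / 2) + g ((s - r) / 2) \<partial>lborel)"
    proof (rule nn_integral_mono)
      fix r :: real
      show "indicator {0..t} s * indicator {0..t} r * e (\<bar>s - r\<bar> / 2) \<le> g ((r - s) / 2) + g ((s - r) / 2)"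
      proof (cases "s \<le> r")
        case True
        then have "indicator {0..t} s * indicator {0..t} r * e (\<bar>s - r\<bar> / 2) \<le> g ((r - s) / 2)"
          by (auto simp: g_def indicator_def)
        then show ?thesis by (rule order_trans) simp
      next
        case False
        then have "indicator {0..t} s * indicator {0..t} r * e (\<bar>s - r\<bar> / 2) \<le> g ((s - r) / 2)"
          by (auto simp: g_def indicator_def)
        then show ?thesis by (rule order_trans) simp
      qed
    qed
    also have "\<dots> = 2 * (\<integral>\<^sup>+v. g v \<partial>lborel) + 2 * (\<integral>\<^sup>+v. g v \<partial>lborel)"
      by (subst nn_integral_add) (simp_all add: aff)
    also have "\<dots> = 4 * (\<integral>\<^sup>+v. g v \<partial>lborel)"
      unfolding distrib_right[symmetric] by simp
    finally show ?thesis using True by simp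
  qed simp
  then have "(\<integral>\<^sup>+s. \<integral>\<^sup>+r. indicator {0..t} s * indicator {0..t} r * e (\<bar>s - r\<bar> / 2) \<partial>lborel \<partial>lborel)
      \<le> (\<integral>\<^sup>+s. (4 * (\<integral>\<^sup>+v. g v \<partial>lborel)) * indicator {0..t} s \<partial>lborel)"
    by (rule nn_integral_mono)
  also have "\<dots> = (4 * (\<integral>\<^sup>+v. g v \<partial>lborel)) * ennreal t"
    using t by (simp add: nn_integral_cmult_indicator)
  also have "\<dots> = ennreal (4 * t) * (\<integral>\<^sup>+v. g v \<partial>lborel)"
    using t by (simp add: ennreal_mult ac_simps)
  finally show ?thesis by (simp add: g_def)
qed

text \<open>As \<open>e\<close> is antimono, \<open>e (\<bar>s - r\<bar> / 2)\<close> is at least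
  \<open>e (2 * \<bar>s - r\<bar>)\<close>. The substitution
  \<open>v = 2 * \<bar>s - r\<bar>\<close> carries an interval of length \<open>t / 2\<close> ending
  or beginning at \<open>s\<close> onto \<open>{0..t}\<close>; its Jacobian is the factor 1/2. The
  interval is taken on the side of \<open>s\<close> where it fits inside
  \<open>{0..t}\<close>.\<close>

lemma nn_integral_abs_diff_lower:
  fixes e :: "real \<Rightarrow> ennreal" and t :: real
  assumes [measurable]: "e \<in> borel_measurable borel" and t: "0 \<le> t" and e: "antimono e"
  shows "ennreal (t / 2) * (\<integral>\<^sup>+v. indicator {0..t} v * e v \<partial>lborel) \<le>
    (\<integral>\<^sup>+s. \<integral>\<^sup>+r. indicator {0..t} s * indicator {0..t} r * e (\<bar>s - r\<bar> / 2) \<partial>lborel \<partial>lborel)"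
proof -
  define g where "g v = indicator {0..t} v * e v" for v
  have [measurable]: "g \<in> borel_measurable borel" unfolding g_def by measurable
  have aff: "(\<integral>\<^sup>+r. g (2 * (r - s)) \<partial>lborel) = ennreal (1 / 2) * (\<integral>\<^sup>+v. g v \<partial>lborel)"
    "(\<integral>\<^sup>+r. g (2 * (s - r)) \<partial>lborel) = ennreal (1 / 2) * (\<integral>\<^sup>+v. g v \<partial>lborel)" for s :: real
    using nn_integral_real_affine[of "\<lambda>r. g (2 * (r - s))" "1 / 2" s]
      nn_integral_real_affine[of "\<lambda>r. g (2 * (s - r))" "- (1 / 2)" s] by simp_all
  have inner: "(ennreal (1 / 2) * (\<integral>\<^sup>+v. g v \<partial>lborel)) * indicator {0..t} s
      \<le> (\<integral>\<^sup>+r. indicator {0..t} s * indicator {0..t} r * e (\<bar>s - r\<bar> / 2) \<partial>lborel)" for s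
  proof (cases "s \<in> {0..t}")
    case s: True
    show ?thesis
    proof (cases "s \<le> t / 2")
      case True
      have "(\<integral>\<^sup>+r. g (2 * (r - s)) \<partial>lborel)
        \<le> (\<integral>\<^sup>+r. indicator {0..t} s * indicator {0..t} r * e (\<bar>s - r\<bar> / 2) \<partial>lborel)"
        using s True by (intro nn_integral_mono) (auto simp: g_def indicator_def intro!: antimonoD[OF e])
      then show ?thesis unfolding aff using s by simp
    next
      case False
      have "(\<integral>\<^sup>+r. g (2 * (s - r)) \<partial>lborel)
        \<le> (\<integral>\<^sup>+r. indicator {0..t} s * indicator {0..t} r * e (\<bar>s - r\<bar> / 2) \<partial>lborel)"
        using s False by (intro nn_integral_mono) (auto simp: g_def indicator_def intro!: antimonoD[OF e])
      then show ?thesis unfolding aff using s by simp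
    qed
  qed simp
  have "ennreal (t / 2) * (\<integral>\<^sup>+v. g v \<partial>lborel) = (ennreal (1 / 2) * (\<integral>\<^sup>+v. g v \<partial>lborel)) * ennreal t"
  proof -
    have "ennreal (t / 2) = ennreal (1 / 2) * ennreal t"
      using t by (subst ennreal_mult[symmetric]) auto
    then show ?thesis by (simp add: ac_simps)
  qed
  also have "\<dots> = (\<integral>\<^sup>+s. (ennreal (1 / 2) * (\<integral>\<^sup>+v. g v \<partial>lborel)) * indicator {0..t} s \<partial>lborel)"
    using t by (simp add: nn_integral_cmult_indicator)
  also have "\<dots> \<le> (\<integral>\<^sup>+s. \<integral>\<^sup>+r. indicator {0..t} s * indicator {0..t} r * e (\<bar>s - r\<bar> / 2) \<partial>lborel \<partial>lborel)"
    by (rule nn_integral_mono) (rule inner)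
  finally show ?thesis by (simp add: g_def)
qed

section \<open>The symmetric process and its measurability\<close>

text \<open>Open sets contained in a compact set cover the space and have finite measure; Lindelof's
  theorem extracts a countable subcover.\<close>

lemma radon_measure_sigma_finite:
  fixes m :: "'a::{metric_space, second_countable_topology} measure"
  assumes lc: "locally compact (UNIV :: 'a set)" and m: "radon_measure m"
  shows "sigma_finite_measure m"
proof
  have sets: "sets m = sets borel" and fin: "\<And>K. compact K \<Longrightarrow> emeasure m K < \<infinity>"
    using m by (auto simp: radon_measure_def)
  then have space: "space m = UNIV" using sets_eq_imp_space_eq[OF sets] by simp
  define F where "F = {U :: 'a set. open U \<and> (\<exists>K. compact K \<and> U \<subseteq> K)}"
  have F_UN: "\<Union>F = UNIV"
  proof -
    have "\<exists>U\<in>F. x \<in> U" for x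
    proof -
      have "openin (top_of_set UNIV) (UNIV :: 'a set) \<and> x \<in> UNIV" by simp
      with lc obtain U K where "open U" "compact K" "x \<in> U" "U \<subseteq> K"
        unfolding locally_def by (metis openin_open_eq open_UNIV inf_top_left open_openin)
      then show ?thesis by (auto simp: F_def)
    qed
    then show ?thesis by blast
  qed
  obtain F' where F': "F' \<subseteq> F" "countable F'" "\<Union>F' = \<Union>F"
    using Lindelof[of F] by (auto simp: F_def)
  show "\<exists>A. countable A \<and> A \<subseteq> sets m \<and> \<Union>A = space m \<and> (\<forall>a\<in>A. emeasure m a \<noteq> \<infinity>)"
  proof (intro exI conjI ballI)
    show "countable F'" "\<Union>F' = space m" using F' F_UN space by auto
    show "F' \<subseteq> sets m" using F'(1) by (auto simp: F_def sets)
    fix U assume "U \<in> F'"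
    then obtain K where "compact K" "U \<subseteq> K" using F'(1) by (auto simp: F_def)
    then have "emeasure m U \<le> emeasure m K"
      by (intro emeasure_mono) (auto simp: sets borel_compact)
    then show "emeasure m U \<noteq> \<infinity>" using fin[OF \<open>compact K\<close>] by (auto simp: top_unique)
  qed
qed

locale symmetric_markov_process = markov_process \<Omega> P X + sigma_finite_measure m
  for \<Omega> :: "'w measure"
    and P :: "'a::{metric_space, second_countable_topology} \<Rightarrow> 'w measure"
    and X :: "real \<Rightarrow> 'w \<Rightarrow> 'a"
    and m :: "'a measure" +
  assumes sets_m[measurable_cong, simp]: "sets m = sets borel"
    and symmetric: "symmetrizing P X m"
begin

lemma space_m[simp]: "space m = UNIV"
  using sets_eq_imp_space_eq[OF sets_m] by simp

lemma borel_measurable_m[simp]: "borel_measurable m = borel_measurable borel"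
  by (rule measurable_cong_sets) simp_all

lemma P_subprob[measurable]: "P \<in> borel \<rightarrow>\<^sub>M subprob_algebra \<Omega>"
  using kernel by (rule measurable_prob_algebraD)

lemma prob_space_P: "prob_space (P x)" and sets_P[measurable_cong, simp]: "sets (P x) = sets \<Omega>"
  using measurable_space[OF kernel, of x] by (auto simp: space_prob_algebra)

lemma space_P[simp]: "space (P x) = space \<Omega>"
  by (rule sets_eq_imp_space_eq) simp

lemma P_subprob_m: "P \<in> m \<rightarrow>\<^sub>M subprob_algebra \<Omega>"
  using P_subprob by (simp add: measurable_cong_sets[OF sets_m refl])

text \<open>Clamping time at 0 extends the process to all real times, so that products with the full
  Borel sigma-algebra can be used instead of a restricted space. The same clamp recurs in later
  integrands.\<close>

lemma X_measurable_pair: "(\<lambda>(t, \<omega>). X (max 0 t) \<omega>) \<in> borel \<Otimes>\<^sub>M \<Omega> \<rightarrow>\<^sub>M borel"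
proof -
  have "(\<lambda>p. (max 0 (fst p), snd p)) \<in> (borel :: real measure) \<Otimes>\<^sub>M \<Omega> \<rightarrow>\<^sub>M restrict_space borel {0..} \<Otimes>\<^sub>M \<Omega>"
    by (intro measurable_Pair measurable_restrict_space2) auto
  from measurable_compose[OF this measurable_process] show ?thesis
    by (simp add: case_prod_beta')
qed

lemma X_measurable: "0 \<le> t \<Longrightarrow> X t \<in> \<Omega> \<rightarrow>\<^sub>M borel"
  using measurable_compose[OF measurable_Pair1'[of t borel \<Omega>] X_measurable_pair] by (simp add: max_absorb2)

lemma transition_measurable_pair:
  assumes f: "f \<in> borel_measurable borel"
  shows "(\<lambda>(t, x). transition P X (max 0 t) f x) \<in> borel_measurable (borel \<Otimes>\<^sub>M borel)"
proof -
  have "(\<lambda>z. \<integral>\<omega>. f (X (max 0 (fst z)) \<omega>) \<partial>P (snd z)) \<in> borel_measurable ((borel :: real measure) \<Otimes>\<^sub>M borel)"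
  proof (rule integral_measurable_kernel)
    have "(\<lambda>z. (fst (fst z), snd z)) \<in> ((borel :: real measure) \<Otimes>\<^sub>M (borel :: 'a measure)) \<Otimes>\<^sub>M \<Omega> \<rightarrow>\<^sub>M borel \<Otimes>\<^sub>M \<Omega>"
      by measurable
    from measurable_compose[OF measurable_compose[OF this X_measurable_pair] f]
    show "(\<lambda>(z, \<omega>). f (X (max 0 (fst z)) \<omega>))
        \<in> borel_measurable (((borel :: real measure) \<Otimes>\<^sub>M (borel :: 'a measure)) \<Otimes>\<^sub>M \<Omega>)"
      by (simp add: case_prod_beta')
    show "(\<lambda>z. P (snd z)) \<in> (borel :: real measure) \<Otimes>\<^sub>M borel \<rightarrow>\<^sub>M subprob_algebra \<Omega>"
      by (rule measurable_compose[OF measurable_snd P_subprob])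
  qed
  then show ?thesis by (simp add: transition_def case_prod_beta')
qed

lemma transition_measurable:
  "0 \<le> t \<Longrightarrow> f \<in> borel_measurable borel \<Longrightarrow> transition P X t f \<in> borel_measurable borel"
  using measurable_compose[OF measurable_Pair1'[of t borel borel] transition_measurable_pair[of f]]
  by (simp add: max_absorb2)

text \<open>\<open>bind\<close> is the mixture of the laws \<open>P x\<close> even though \<open>m\<close> may be infinite.\<close>

definition law :: "'w measure" where "law = m \<bind> P"

lemma sets_law[measurable_cong, simp]: "sets law = sets \<Omega>"
  unfolding law_def by (rule sets_bind) auto

lemma space_law[simp]: "space law = space \<Omega>"
  by (rule sets_eq_imp_space_eq) simp

lemma nn_integral_law:
  "f \<in> borel_measurable \<Omega> \<Longrightarrow> (\<integral>\<^sup>+\<omega>. f \<omega> \<partial>law) = (\<integral>\<^sup>+x. \<integral>\<^sup>+\<omega>. f \<omega> \<partial>P x \<partial>m)"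
  unfolding law_def by (rule nn_integral_bind[OF _ P_subprob_m])

section \<open>Stationarity and contraction\<close>

lemma transition_indicator:
  assumes "0 \<le> t" "A \<in> sets borel"
  shows "ennreal (transition P X t (indicator A) x) = emeasure (P x) (X t -` A \<inter> space \<Omega>)"
    and "0 \<le> transition P X t (indicator A) x" "transition P X t (indicator A) x \<le> 1"
proof -
  interpret P: prob_space "P x" by (rule prob_space_P)
  have [measurable]: "X t -` A \<inter> space \<Omega> \<in> sets \<Omega>"
    using X_measurable[OF assms(1)] assms(2) by (rule measurable_sets)
  have "transition P X t (indicator A) x = (\<integral>\<omega>. indicator (X t -` A \<inter> space \<Omega>) \<omega> \<partial>P x)"
    unfolding transition_def by (rule Bochner_Integration.integral_cong) (auto simp: indicator_def)
  also have "\<dots> = measure (P x) (X t -` A \<inter> space \<Omega>)"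
    by simp
  finally have *: "transition P X t (indicator A) x = measure (P x) (X t -` A \<inter> space \<Omega>)" .
  show "ennreal (transition P X t (indicator A) x) = emeasure (P x) (X t -` A \<inter> space \<Omega>)"
    by (simp add: * P.emeasure_eq_measure)
  show "0 \<le> transition P X t (indicator A) x" "transition P X t (indicator A) x \<le> 1"
    by (simp_all add: * P.prob_le_1)
qed

lemma kernel_emeasure_measurable:
  "0 \<le> t \<Longrightarrow> A \<in> sets borel \<Longrightarrow> (\<lambda>x. emeasure (P x) (X t -` A \<inter> space \<Omega>)) \<in> borel_measurable borel"
  by (rule measurable_compose[OF P_subprob measurable_emeasure_subprob_algebra])
    (rule measurable_sets[OF X_measurable])

text \<open>Symmetry is given for Bochner integrals of square-integrable functions. Restated for
  sets of finite measure in \<open>ennreal\<close>, it becomes accessible to monotone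
  limits.\<close>

lemma indicator_symmetric:
  assumes t: "0 \<le> t" and A: "A \<in> sets borel" "emeasure m A < \<infinity>"
    and B: "B \<in> sets borel" "emeasure m B < \<infinity>"
  shows "(\<integral>\<^sup>+x. emeasure (P x) (X t -` A \<inter> space \<Omega>) * indicator B x \<partial>m)
    = (\<integral>\<^sup>+x. indicator A x * emeasure (P x) (X t -` B \<inter> space \<Omega>) \<partial>m)"
proof -
  have L2: "indicator C \<in> L2 m" if "C \<in> sets borel" "emeasure m C < \<infinity>" for C
  proof -
    have "(\<lambda>x. (indicator C x)\<^sup>2) = (indicator C :: 'a \<Rightarrow> real)"
      by (auto simp: fun_eq_iff indicator_def)
    then show ?thesis
      using that by (auto simp: L2_def intro!: integrable_real_indicator)
  qed
  have *: "(\<integral>\<^sup>+x. emeasure (P x) (X t -` C \<inter> space \<Omega>) * indicator D x \<partial>m)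
      = ennreal (\<integral>x. transition P X t (indicator C) x * indicator D x \<partial>m)"
    if C: "C \<in> sets borel" and D: "D \<in> sets borel" "emeasure m D < \<infinity>" for C D
  proof -
    note [measurable] = transition_measurable[OF t, of "indicator C"] C D(1)
    have "integrable m (\<lambda>x. transition P X t (indicator C) x * indicator D x)"
    proof (rule Bochner_Integration.integrable_bound)
      show "integrable m (indicator D :: _ \<Rightarrow> real)"
        using D by (intro integrable_real_indicator) auto
      show "AE x in m. norm (transition P X t (indicator C) x * indicator D x) \<le> norm (indicator D x :: real)"
        using transition_indicator(2,3)[OF t C] by (auto simp: indicator_def)
    qed measurable
    then have "ennreal (\<integral>x. transition P X t (indicator C) x * indicator D x \<partial>m)
        = (\<integral>\<^sup>+x. ennreal (transition P X t (indicator C) x * indicator D x) \<partial>m)"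
      using transition_indicator(2)[OF t C] by (intro nn_integral_eq_integral[symmetric]) auto
    also have "\<dots> = (\<integral>\<^sup>+x. emeasure (P x) (X t -` C \<inter> space \<Omega>) * indicator D x \<partial>m)"
      using transition_indicator(1)[OF t C] by (intro nn_integral_cong) (auto simp: indicator_def)
    finally show ?thesis by simp
  qed
  have "(\<integral>x. transition P X t (indicator A) x * indicator B x \<partial>m)
      = (\<integral>x. indicator A x * transition P X t (indicator B) x \<partial>m)"
    using symmetric t L2[OF A] L2[OF B] by (auto simp: symmetrizing_def)
  then show ?thesis
    using *[OF A(1) B] *[OF B(1) A] by (simp add: mult.commute)
qed

text \<open>Pair with the indicators of an exhausting sequence \<open>B\<close> of sets of finite
  measure, move the operator onto them by symmetry, and let them increase to 1.\<close>

lemma invariant_finite: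
  assumes t: "0 \<le> t" and A: "A \<in> sets borel" "emeasure m A < \<infinity>"
  shows "(\<integral>\<^sup>+x. emeasure (P x) (X t -` A \<inter> space \<Omega>) \<partial>m) = emeasure m A"
proof -
  obtain B :: "nat \<Rightarrow> 'a set" where B: "range B \<subseteq> sets m" "(\<Union>i. B i) = space m"
      "\<And>i. emeasure m (B i) \<noteq> \<infinity>" "incseq B"
    using sigma_finite_incseq by metis
  then have B': "B i \<in> sets borel" "emeasure m (B i) < \<infinity>" for i by (auto simp: less_top)
  note [measurable] = kernel_emeasure_measurable[OF t] A(1) B'(1)
  have inc_ind: "incseq (\<lambda>i x. indicator (B i) x :: ennreal)"
    using B(4) by (auto simp: incseq_def le_fun_def indicator_def)
  have cover: "\<exists>i. x \<in> B i" for x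
    using B(2) by (metis UNIV_I UN_iff space_m)
  have sup_ind: "(SUP i. indicator (B i) x :: ennreal) = 1" for x
  proof (rule antisym)
    obtain i where "x \<in> B i" using cover by blast
    then show "1 \<le> (SUP i. indicator (B i) x :: ennreal)"
      by (intro SUP_upper2[of i]) auto
  qed (auto intro!: SUP_least simp: indicator_def)
  \<comment> \<open>Here the absence of killing enters: every path is somewhere in the state space
    at time \<open>t\<close>, so the preimages of the sets \<open>B i\<close> exhaust
    \<Omega>.\<close>
  have sup_P: "(SUP i. emeasure (P x) (X t -` B i \<inter> space \<Omega>)) = 1" for x
  proof -
    interpret P: prob_space "P x" by (rule prob_space_P)
    have "(SUP i. emeasure (P x) (X t -` B i \<inter> space \<Omega>)) = emeasure (P x) (\<Union>i. X t -` B i \<inter> space \<Omega>)"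
      using B(4) B'(1) by (intro SUP_emeasure_incseq)
        (auto simp: incseq_def intro!: measurable_sets[OF X_measurable[OF t]])
    also have "(\<Union>i. X t -` B i \<inter> space \<Omega>) = space (P x)"
      using cover by auto
    finally show ?thesis using P.emeasure_space_1 by simp
  qed
  have "(\<integral>\<^sup>+x. emeasure (P x) (X t -` A \<inter> space \<Omega>) \<partial>m)
      = (\<integral>\<^sup>+x. (SUP i. emeasure (P x) (X t -` A \<inter> space \<Omega>) * indicator (B i) x) \<partial>m)"
    unfolding SUP_mult_left_ennreal[symmetric] sup_ind by simp
  also have "\<dots> = (SUP i. \<integral>\<^sup>+x. emeasure (P x) (X t -` A \<inter> space \<Omega>) * indicator (B i) x \<partial>m)"
    by (rule nn_integral_monotone_convergence_SUP)
      (use inc_ind in \<open>auto simp: incseq_def le_fun_def intro!: mult_left_mono\<close>)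
  also have "\<dots> = (SUP i. \<integral>\<^sup>+x. indicator A x * emeasure (P x) (X t -` B i \<inter> space \<Omega>) \<partial>m)"
    by (intro SUP_cong refl indicator_symmetric t A B')
  also have "\<dots> = (\<integral>\<^sup>+x. (SUP i. indicator A x * emeasure (P x) (X t -` B i \<inter> space \<Omega>)) \<partial>m)"
    by (rule nn_integral_monotone_convergence_SUP[symmetric])
      (use B(4) in \<open>auto simp: incseq_def le_fun_def
        intro!: mult_left_mono emeasure_mono measurable_sets[OF X_measurable[OF t]]\<close>)
  also have "\<dots> = emeasure m A"
    unfolding SUP_mult_left_ennreal[symmetric] sup_P by simp
  finally show ?thesis .
qed

text \<open>Stationarity, extended from sets of finite measure to all Borel sets by continuity from
  below along \<open>A \<inter> B i\<close>.\<close>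

lemma distr_law:
  assumes t: "0 \<le> t"
  shows "distr law borel (X t) = m"
proof (rule measure_eqI)
  fix A assume "A \<in> sets (distr law borel (X t))"
  then have A[measurable]: "A \<in> sets borel" by simp
  obtain B :: "nat \<Rightarrow> 'a set" where B: "range B \<subseteq> sets m" "(\<Union>i. B i) = space m"
      "\<And>i. emeasure m (B i) \<noteq> \<infinity>" "incseq B"
    using sigma_finite_incseq by metis
  then have B': "B i \<in> sets borel" "emeasure m (B i) < \<infinity>" for i by (auto simp: less_top)
  have fin: "emeasure (distr law borel (X t)) (A \<inter> B i) = emeasure m (A \<inter> B i)" for i
  proof -
    have X[measurable]: "X t \<in> \<Omega> \<rightarrow>\<^sub>M borel" using t by (rule X_measurable)
    have C[measurable]: "A \<inter> B i \<in> sets borel" using A B'(1) by auto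
    have "emeasure (distr law borel (X t)) (A \<inter> B i) = emeasure law (X t -` (A \<inter> B i) \<inter> space \<Omega>)"
      by (subst emeasure_distr) auto
    also have "\<dots> = (\<integral>\<^sup>+x. emeasure (P x) (X t -` (A \<inter> B i) \<inter> space \<Omega>) \<partial>m)"
      unfolding law_def by (rule emeasure_bind[OF _ P_subprob_m measurable_sets[OF X C]]) simp
    also have "\<dots> = emeasure m (A \<inter> B i)"
      using B' by (intro invariant_finite t C) (auto intro: order.strict_trans1[OF emeasure_mono])
    finally show ?thesis .
  qed
  have UN: "(\<Union>i. A \<inter> B i) = A" using B(2) by auto
  have rng: "range (\<lambda>i. A \<inter> B i) \<subseteq> sets borel" using B'(1) by auto
  have inc: "incseq (\<lambda>i. A \<inter> B i)" using B(4) by (auto simp: incseq_def)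
  have "emeasure (distr law borel (X t)) A = (SUP i. emeasure (distr law borel (X t)) (A \<inter> B i))"
    using SUP_emeasure_incseq[OF _ inc, of "distr law borel (X t)"] rng unfolding UN by simp
  also have "\<dots> = emeasure m A"
    using SUP_emeasure_incseq[OF _ inc, of m] rng unfolding UN fin by simp
  finally show "emeasure (distr law borel (X t)) A = emeasure m A" .
qed simp

lemma nn_integral_law_X:
  assumes "0 \<le> t" and [measurable]: "f \<in> borel_measurable borel"
  shows "(\<integral>\<^sup>+\<omega>. f (X t \<omega>) \<partial>law) = (\<integral>\<^sup>+x. f x \<partial>m)"
  using X_measurable[OF assms(1)] by (subst distr_law[OF assms(1), symmetric]) (simp add: nn_integral_distr)

lemma invariant:
  assumes t: "0 \<le> t" and f: "f \<in> borel_measurable borel"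
  shows "(\<integral>\<^sup>+x. \<integral>\<^sup>+\<omega>. f (X t \<omega>) \<partial>P x \<partial>m) = (\<integral>\<^sup>+x. f x \<partial>m)"
  using nn_integral_law[OF measurable_compose[OF X_measurable[OF t] f]] nn_integral_law_X[OF t f] by simp

text \<open>The image of \<open>law\<close> under \<open>X 0\<close> is \<open>m\<close>, so
  preimages of an exhaustion for \<open>m\<close> exhaust \<Omega>. This permits Fubini between
  chance and time.\<close>

lemma sigma_finite_law: "sigma_finite_measure law"
proof (rule sigma_finite_measure_distr)
  show "sigma_finite_measure (distr law borel (X 0))"
    unfolding distr_law[OF order_refl] by unfold_locales
  show "X 0 \<in> law \<rightarrow>\<^sub>M borel" using X_measurable[of 0] by (simp add: measurable_cong_sets[OF sets_law refl])
qed

lemma X_L2_law: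
  assumes t: "0 \<le> t" and f: "f \<in> L2 m"
  shows "(\<lambda>\<omega>. f (X t \<omega>)) \<in> L2 law"
proof -
  have [measurable]: "f \<in> borel_measurable borel" "X t \<in> \<Omega> \<rightarrow>\<^sub>M borel"
    using f X_measurable[OF t] by (auto simp: L2_iff)
  show ?thesis
    using nn_integral_law_X[OF t, of "\<lambda>x. ennreal ((f x)\<^sup>2)"] f
    by (simp add: L2_iff)
qed

text \<open>Jensen under each \<open>P x\<close>, then stationarity.\<close>

lemma transition_L2:
  assumes t: "0 \<le> t" and f: "f \<in> L2 m"
  shows "(\<integral>\<^sup>+x. ennreal ((transition P X t f x)\<^sup>2) \<partial>m) \<le> (\<integral>\<^sup>+x. ennreal ((f x)\<^sup>2) \<partial>m)"
    and "transition P X t f \<in> L2 m"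
proof -
  have fb[measurable]: "f \<in> borel_measurable borel" and X[measurable]: "X t \<in> \<Omega> \<rightarrow>\<^sub>M borel"
    using f X_measurable[OF t] by (auto simp: L2_iff)
  have "(\<integral>\<^sup>+x. ennreal ((transition P X t f x)\<^sup>2) \<partial>m) \<le> (\<integral>\<^sup>+x. \<integral>\<^sup>+\<omega>. ennreal ((f (X t \<omega>))\<^sup>2) \<partial>P x \<partial>m)"
    unfolding transition_def
    by (intro nn_integral_mono prob_space.square_integral_le_nn_integral prob_space_P) measurable
  also have "\<dots> = (\<integral>\<^sup>+x. ennreal ((f x)\<^sup>2) \<partial>m)"
    by (rule invariant[OF t]) measurable
  finally show *: "(\<integral>\<^sup>+x. ennreal ((transition P X t f x)\<^sup>2) \<partial>m) \<le> (\<integral>\<^sup>+x. ennreal ((f x)\<^sup>2) \<partial>m)" .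
  show "transition P X t f \<in> L2 m"
    using order.strict_trans1[OF *] f transition_measurable[OF t fb] by (simp add: L2_iff)
qed

section \<open>Semigroup law and correlations for bounded functions\<close>

text \<open>Multiply the Markov property by \<open>g (X r \<omega>)\<close>, which is measurable for
  the past up to time \<open>r\<close>, and take expectations. The bounds on \<open>f\<close> and
  \<open>g\<close> ensure integrability.\<close>

lemma markov_bounded:
  fixes f g :: "'a \<Rightarrow> real"
  assumes r: "0 \<le> r" and t: "0 \<le> t"
    and f: "f \<in> borel_measurable borel" "\<And>x. \<bar>f x\<bar> \<le> C"
    and g: "g \<in> borel_measurable borel" "\<And>x. \<bar>g x\<bar> \<le> D"
  shows "(\<integral>\<omega>. g (X r \<omega>) * f (X (r + t) \<omega>) \<partial>P x) = transition P X r (\<lambda>y. g y * transition P X t f y) x"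
proof -
  interpret P: prob_space "P x" by (rule prob_space_P)
  let ?F = "natural_filtration \<Omega> X r"
  let ?G = "{X s -` B \<inter> space \<Omega> | s B. s \<in> {0..r} \<and> B \<in> sets borel}"
  have G: "?G \<subseteq> sets \<Omega>" by (auto intro!: measurable_sets[OF X_measurable])
  then have GP: "?G \<subseteq> Pow (space \<Omega>)" using sets.space_closed[of \<Omega>] by blast
  have "subalgebra (P x) ?F"
    unfolding subalgebra_def natural_filtration_def using G GP
    by (simp add: sets_measure_of space_measure_of sets.sigma_sets_subset)
  then interpret F: finite_measure_subalgebra "P x" ?F
    by unfold_locales
  have XF: "X r \<in> ?F \<rightarrow>\<^sub>M borel"
  proof (rule measurableI)
    show "X r -` A \<inter> space ?F \<in> sets ?F" if "A \<in> sets borel" for A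
      using that r GP unfolding natural_filtration_def
      by (auto simp: sets_measure_of space_measure_of)
  qed auto
  have [measurable]: "X r \<in> \<Omega> \<rightarrow>\<^sub>M borel" "X (r + t) \<in> \<Omega> \<rightarrow>\<^sub>M borel"
    "f \<in> borel_measurable borel" "g \<in> borel_measurable borel"
    "transition P X t f \<in> borel_measurable borel"
    using r t f g by (auto intro!: X_measurable transition_measurable)
  have "\<bar>g y * f z\<bar> \<le> D * C" for y z
    unfolding abs_mult using f(2)[of z] g(2)[of y] by (intro mult_mono) auto
  then have "integrable (P x) (\<lambda>\<omega>. g (X r \<omega>) * f (X (r + t) \<omega>))"
    by (intro P.integrable_const_bound[where B = "D * C"]) auto
  then have "(\<integral>\<omega>. g (X r \<omega>) * f (X (r + t) \<omega>) \<partial>P x)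
      = (\<integral>\<omega>. g (X r \<omega>) * real_cond_exp (P x) ?F (\<lambda>\<omega>. f (X (r + t) \<omega>)) \<omega> \<partial>P x)"
    using g(1) by (intro F.real_cond_exp_intg(2)[symmetric] measurable_compose[OF XF]) auto
  also have "\<dots> = (\<integral>\<omega>. g (X r \<omega>) * transition P X t f (X r \<omega>) \<partial>P x)"
  proof (rule integral_cong_AE)
    have "bounded (range f)" using f(2) by (auto simp: bounded_iff)
    from markov_property[OF r t f(1) this, of x]
    show "AE \<omega> in P x. g (X r \<omega>) * real_cond_exp (P x) ?F (\<lambda>\<omega>. f (X (r + t) \<omega>)) \<omega>
        = g (X r \<omega>) * transition P X t f (X r \<omega>)"
      by eventually_elim simp
  qed measurable
  finally show ?thesis by (simp add: transition_def)
qed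

text \<open>Chapman-Kolmogorov, the case \<open>g = 1\<close> of
  \<open>markov_bounded\<close>.\<close>

lemma transition_add:
  assumes "0 \<le> r" "0 \<le> t" and f: "f \<in> borel_measurable borel" "\<And>x. \<bar>f x\<bar> \<le> C"
  shows "transition P X (r + t) f x = transition P X r (transition P X t f) x"
  using markov_bounded[OF assms, of "\<lambda>_. 1" 1 x] by (simp add: transition_def)

text \<open>The Markov property produces the operator at time \<open>2 * v\<close> and stationarity
  removes \<open>r\<close>. The semigroup law then splits the operator into two equal factors, and
  symmetry moves one of them to the other side, which leaves a square.\<close>

lemma correlation_bounded:
  assumes r: "0 \<le> r" and v: "0 \<le> v" and f: "f \<in> L2 m" "\<And>x. \<bar>f x\<bar> \<le> C"
  shows "(\<integral>\<omega>. f (X r \<omega>) * f (X (r + 2 * v) \<omega>) \<partial>law) = (\<integral>x. (transition P X v f x)\<^sup>2 \<partial>m)"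
proof -
  have [measurable]: "f \<in> borel_measurable borel" "X r \<in> \<Omega> \<rightarrow>\<^sub>M borel" "X (r + 2 * v) \<in> \<Omega> \<rightarrow>\<^sub>M borel"
    "transition P X (2 * v) f \<in> borel_measurable borel"
    using f X_measurable[of r] X_measurable[of "r + 2 * v"] r v by (auto simp: L2_iff intro!: transition_measurable)
  let ?T = "transition P X"
  have Tf: "?T v f \<in> L2 m" "?T (2 * v) f \<in> L2 m"
    using v f by (auto intro!: transition_L2)
  have T2: "?T (2 * v) f x = ?T v (?T v f) x" for x
    unfolding mult_2 by (rule transition_add[OF v v _ f(2)]) measurable
  have "(\<integral>\<omega>. f (X r \<omega>) * f (X (r + 2 * v) \<omega>) \<partial>law)
      = (\<integral>x. \<integral>\<omega>. f (X r \<omega>) * f (X (r + 2 * v) \<omega>) \<partial>P x \<partial>m)"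
    unfolding law_def
    by (intro integral_bind_kernel(2)[OF P_subprob_m])
      (use r v f in \<open>auto simp flip: law_def intro!: L2_mult_integrable X_L2_law\<close>)
  \<comment> \<open>The Markov property is available under each \<open>P x\<close>, stationarity
    only under \<open>law\<close>; hence the disintegration before this step and the reassembly
    after it.\<close>
  also have "\<dots> = (\<integral>x. \<integral>\<omega>. f (X r \<omega>) * ?T (2 * v) f (X r \<omega>) \<partial>P x \<partial>m)"
    using markov_bounded[OF r, of "2 * v" f C f C] v f
    by (simp add: transition_def)
  also have "\<dots> = (\<integral>\<omega>. f (X r \<omega>) * ?T (2 * v) f (X r \<omega>) \<partial>law)"
    unfolding law_def
    by (intro integral_bind_kernel(2)[OF P_subprob_m, symmetric])
      (use r v f Tf in \<open>auto simp flip: law_def intro!: L2_mult_integrable X_L2_law\<close>)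
  also have "\<dots> = (\<integral>x. f x * ?T (2 * v) f x \<partial>m)"
    by (subst distr_law[OF r, symmetric]) (simp add: integral_distr)
  also have "\<dots> = (\<integral>x. f x * ?T v (?T v f) x \<partial>m)"
    by (simp only: T2)
  also have "\<dots> = (\<integral>x. ?T v f x * ?T v f x \<partial>m)"
    using symmetric v f(1) Tf(1) by (simp add: symmetrizing_def)
  finally show ?thesis by (simp add: power2_eq_square)
qed

section \<open>Energy and passage to square-integrable functions\<close>

text \<open>By stationarity, \<open>f (X v \<omega>)\<close> has a finite second moment under
  \<open>P x\<close> for almost every \<open>x\<close>, so dominated convergence applies there. The
  bound, uniform in \<open>n\<close>, serves as majorant when integrating over \<open>x\<close>
  next.\<close>

lemma transition_trunc:
  assumes v: "0 \<le> v" and f: "f \<in> L2 m"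
  shows "AE x in m. (\<lambda>n. transition P X v (trunc f n) x) \<longlonglongrightarrow> transition P X v f x
    \<and> (\<forall>n. \<bar>transition P X v (trunc f n) x\<bar> \<le> transition P X v (\<lambda>x. \<bar>f x\<bar>) x)"
proof -
  have [measurable]: "f \<in> borel_measurable borel" and X[measurable]: "X v \<in> \<Omega> \<rightarrow>\<^sub>M borel"
    using f X_measurable[OF v] by (auto simp: L2_iff)
  have "(\<integral>\<^sup>+x. \<integral>\<^sup>+\<omega>. ennreal ((f (X v \<omega>))\<^sup>2) \<partial>P x \<partial>m) < \<infinity>"
    using invariant[OF v, of "\<lambda>x. ennreal ((f x)\<^sup>2)"] f by (simp add: L2_iff)
  moreover have "(\<lambda>x. \<integral>\<^sup>+\<omega>. ennreal ((f (X v \<omega>))\<^sup>2) \<partial>P x) \<in> borel_measurable m"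
    by (intro measurable_compose[OF P_subprob_m] nn_integral_measurable_subprob_algebra) measurable
  ultimately have "AE x in m. (\<integral>\<^sup>+\<omega>. ennreal ((f (X v \<omega>))\<^sup>2) \<partial>P x) \<noteq> \<infinity>"
    by (intro nn_integral_PInf_AE) auto
  then show ?thesis
  proof eventually_elim
    case (elim x)
    interpret P: prob_space "P x" by (rule prob_space_P)
    have "integrable (P x) (\<lambda>\<omega>. (f (X v \<omega>))\<^sup>2)"
      using elim by (intro integrableI_nonneg) (auto simp: less_top)
    then have int: "integrable (P x) (\<lambda>\<omega>. f (X v \<omega>))"
      by (rule P.square_integrable_imp_integrable[rotated]) simp
    have "(\<lambda>n. transition P X v (trunc f n) x) \<longlonglongrightarrow> transition P X v f x"
      unfolding transition_def
      by (rule integral_dominated_convergence[where w = "\<lambda>\<omega>. \<bar>f (X v \<omega>)\<bar>"])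
        (use int in \<open>auto intro!: trunc_tendsto abs_trunc_le\<close>)
    moreover have "\<bar>transition P X v (trunc f n) x\<bar> \<le> transition P X v (\<lambda>x. \<bar>f x\<bar>) x" for n
    proof -
      have "norm (\<integral>\<omega>. trunc f n (X v \<omega>) \<partial>P x) \<le> (\<integral>\<omega>. norm (trunc f n (X v \<omega>)) \<partial>P x)"
        by (rule integral_norm_bound)
      also have "\<dots> \<le> (\<integral>\<omega>. \<bar>f (X v \<omega>)\<bar> \<partial>P x)"
        using int by (intro integral_mono') (auto intro!: abs_trunc_le)
      finally show ?thesis by (simp add: transition_def)
    qed
    ultimately show ?case by blast
  qed
qed

text \<open>The function \<open>H\<close> of the overview. Only nonnegative \<open>v\<close> have a
  meaning; integrals over all reals therefore use \<open>max 0 v\<close>.\<close>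

definition energy :: "('a \<Rightarrow> real) \<Rightarrow> real \<Rightarrow> real" where
  "energy f v = (\<integral>x. (transition P X v f x)\<^sup>2 \<partial>m)"

lemma ennreal_energy:
  assumes "0 \<le> v" "f \<in> L2 m"
  shows "ennreal (energy f v) = (\<integral>\<^sup>+x. ennreal ((transition P X v f x)\<^sup>2) \<partial>m)"
  unfolding energy_def using transition_L2(2)[OF assms]
  by (intro nn_integral_eq_integral[symmetric]) (auto simp: L2_def)

lemma energy_nonneg: "0 \<le> energy f v"
  unfolding energy_def by simp

lemma trunc_L2: "f \<in> L2 m \<Longrightarrow> trunc f n \<in> L2 m"
  by (rule L2_mono[of f]) (auto simp: L2_def intro!: abs_trunc_le)

text \<open>The majorant is the square of the operator applied to \<open>\<bar>f x\<bar>\<close>,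
  integrable because the operator is a contraction and \<open>\<bar>f x\<bar>\<close> is
  square-integrable with \<open>f\<close>.\<close>

lemma energy_trunc_tendsto:
  assumes v: "0 \<le> v" and f: "f \<in> L2 m"
  shows "(\<lambda>n. energy (trunc f n) v) \<longlonglongrightarrow> energy f v"
  unfolding energy_def
proof (rule integral_dominated_convergence[where w = "\<lambda>x. (transition P X v (\<lambda>x. \<bar>f x\<bar>) x)\<^sup>2"])
  have fb[measurable]: "f \<in> borel_measurable borel" using f by (auto simp: L2_iff)
  have "(\<lambda>x. \<bar>f x\<bar>) \<in> L2 m" by (rule L2_mono[OF f]) auto
  from transition_L2(2)[OF v this]
  show "integrable m (\<lambda>x. (transition P X v (\<lambda>x. \<bar>f x\<bar>) x)\<^sup>2)" by (simp add: L2_def)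
  show "(\<lambda>x. (transition P X v f x)\<^sup>2) \<in> borel_measurable m"
    "(\<lambda>x. (transition P X v (trunc f n) x)\<^sup>2) \<in> borel_measurable m" for n
    by (auto intro!: borel_measurable_power transition_measurable v)
  show "AE x in m. (\<lambda>n. (transition P X v (trunc f n) x)\<^sup>2) \<longlonglongrightarrow> (transition P X v f x)\<^sup>2"
    using transition_trunc[OF v f] by eventually_elim (auto intro: tendsto_power)
  show "AE x in m. norm ((transition P X v (trunc f n) x)\<^sup>2) \<le> (transition P X v (\<lambda>x. \<bar>f x\<bar>) x)\<^sup>2" for n
    using transition_trunc[OF v f]
  proof eventually_elim
    case (elim x)
    then have "\<bar>transition P X v (trunc f n) x\<bar>\<^sup>2 \<le> (transition P X v (\<lambda>x. \<bar>f x\<bar>) x)\<^sup>2"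
      by (intro power_mono) auto
    then show ?case by simp
  qed
qed

text \<open>Going from time \<open>s\<close> to time \<open>t\<close> applies the contraction for
  time \<open>t - s\<close>. This uses the semigroup law, known for bounded functions, so it is done
  for truncations and passed to the limit.\<close>

lemma energy_antimono:
  assumes s: "0 \<le> s" "s \<le> t" and f: "f \<in> L2 m"
  shows "energy f t \<le> energy f s"
proof (rule LIMSEQ_le)
  show "(\<lambda>n. energy (trunc f n) t) \<longlonglongrightarrow> energy f t" "(\<lambda>n. energy (trunc f n) s) \<longlonglongrightarrow> energy f s"
    using s f by (auto intro!: energy_trunc_tendsto)
  have "energy (trunc f n) t \<le> energy (trunc f n) s" for n
  proof -
    note L = trunc_L2[OF f, of n]
    have "trunc f n \<in> borel_measurable borel" using L by (auto simp: L2_iff)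
    from transition_add[OF _ s(1) this abs_trunc_le(2), of "t - s"] s
    have "transition P X t (trunc f n) = transition P X (t - s) (transition P X s (trunc f n))"
      by auto
    then have "ennreal (energy (trunc f n) t) \<le> ennreal (energy (trunc f n) s)"
      using transition_L2(1)[of "t - s" "transition P X s (trunc f n)"] transition_L2(2)[OF s(1) L] s L
      by (simp add: ennreal_energy)
    then show ?thesis by (simp add: energy_nonneg)
  qed
  then show "\<exists>N. \<forall>n\<ge>N. energy (trunc f n) t \<le> energy (trunc f n) s" by blast
qed

text \<open>Both sides converge along truncations. On the left, the product for \<open>f\<close>
  itself dominates, integrable because \<open>f (X r \<omega>)\<close> and
  \<open>f (X (r + 2 * v) \<omega>)\<close> are square-integrable under \<open>law\<close>.\<close>

lemma correlation:
  assumes r: "0 \<le> r" and v: "0 \<le> v" and f: "f \<in> L2 m"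
  shows "(\<integral>\<omega>. f (X r \<omega>) * f (X (r + 2 * v) \<omega>) \<partial>law) = energy f v"
proof (rule LIMSEQ_unique)
  have [measurable]: "f \<in> borel_measurable borel" "X r \<in> \<Omega> \<rightarrow>\<^sub>M borel" "X (r + 2 * v) \<in> \<Omega> \<rightarrow>\<^sub>M borel"
    using f X_measurable[of r] X_measurable[of "r + 2 * v"] r v by (auto simp: L2_iff)
  have eq: "(\<integral>\<omega>. trunc f n (X r \<omega>) * trunc f n (X (r + 2 * v) \<omega>) \<partial>law) = energy (trunc f n) v" for n
    unfolding energy_def by (rule correlation_bounded[OF r v trunc_L2[OF f] abs_trunc_le(2)])
  have "(\<lambda>n. \<integral>\<omega>. trunc f n (X r \<omega>) * trunc f n (X (r + 2 * v) \<omega>) \<partial>law)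
      \<longlonglongrightarrow> (\<integral>\<omega>. f (X r \<omega>) * f (X (r + 2 * v) \<omega>) \<partial>law)"
  proof (rule integral_dominated_convergence[where w = "\<lambda>\<omega>. \<bar>f (X r \<omega>) * f (X (r + 2 * v) \<omega>)\<bar>"])
    show "integrable law (\<lambda>\<omega>. \<bar>f (X r \<omega>) * f (X (r + 2 * v) \<omega>)\<bar>)"
      using r v f by (intro integrable_abs L2_mult_integrable X_L2_law) auto
    show "AE \<omega> in law. (\<lambda>n. trunc f n (X r \<omega>) * trunc f n (X (r + 2 * v) \<omega>))
        \<longlonglongrightarrow> f (X r \<omega>) * f (X (r + 2 * v) \<omega>)"
      by (intro AE_I2 tendsto_mult trunc_tendsto)
    show "AE \<omega> in law. norm (trunc f n (X r \<omega>) * trunc f n (X (r + 2 * v) \<omega>))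
        \<le> \<bar>f (X r \<omega>) * f (X (r + 2 * v) \<omega>)\<bar>" for n
      by (auto simp: abs_mult intro!: AE_I2 mult_mono abs_trunc_le)
  qed measurable
  then show "(\<lambda>n. energy (trunc f n) v) \<longlonglongrightarrow> (\<integral>\<omega>. f (X r \<omega>) * f (X (r + 2 * v) \<omega>) \<partial>law)"
    by (simp only: eq)
  show "(\<lambda>n. energy (trunc f n) v) \<longlonglongrightarrow> energy f v"
    by (rule energy_trunc_tendsto[OF v f])
qed

lemma correlation_abs:
  assumes "0 \<le> r" "0 \<le> s" and f: "f \<in> L2 m"
  shows "(\<integral>\<omega>. f (X s \<omega>) * f (X r \<omega>) \<partial>law) = energy f (\<bar>s - r\<bar> / 2)"
proof (cases "s \<le> r")
  case True
  then show ?thesis using correlation[OF assms(2) _ f, of "(r - s) / 2"] by (simp add: field_simps)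
next
  case False
  then show ?thesis using correlation[OF assms(1) _ f, of "(s - r) / 2"]
    by (simp add: field_simps)
qed

lemma energy_measurable:
  assumes f: "f \<in> L2 m"
  shows "(\<lambda>v. energy f (max 0 v)) \<in> borel_measurable borel"
proof -
  have "f \<in> borel_measurable borel" using f by (auto simp: L2_iff)
  from transition_measurable_pair[OF this]
  have "(\<lambda>(v, x). (transition P X (max 0 v) f x)\<^sup>2) \<in> borel_measurable (borel \<Otimes>\<^sub>M borel)"
    by (simp add: case_prod_beta' borel_measurable_power)
  then have "(\<lambda>(v, x). (transition P X (max 0 v) f x)\<^sup>2) \<in> borel_measurable (borel \<Otimes>\<^sub>M m)"
    by (simp add: measurable_cong_sets[OF sets_pair_measure_cong[OF refl sets_m] refl])
  then show ?thesis
    unfolding energy_def by (rule borel_measurable_lebesgue_integral)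
qed

lemma energy_le_norm:
  assumes "0 \<le> v" "f \<in> L2 m"
  shows "ennreal (energy f v) \<le> (\<integral>\<^sup>+x. ennreal ((f x)\<^sup>2) \<partial>m)"
  using transition_L2(1)[OF assms] by (simp add: ennreal_energy assms)

section \<open>Second moments of the weak solution and of the occupation measure\<close>

text \<open>Integrating over space first gives the energy at time \<open>t - s\<close>, and time
  reversal turns this into \<open>v\<close>. The result is finite since the energy never exceeds the
  squared norm of \<open>f\<close>.\<close>

lemma weak_solution_integrand:
  assumes t: "0 \<le> t" and f: "f \<in> L2 m"
  defines "h \<equiv> \<lambda>(s, x). indicator {0..t} s * transition P X (t - s) f x"
  shows "(\<integral>\<^sup>+z. ennreal ((h z)\<^sup>2) \<partial>space_time m)
      = (\<integral>\<^sup>+v. indicator {0..t} v * ennreal (energy f (max 0 v)) \<partial>lborel)" (is ?E)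
    and "h \<in> L2 (space_time m)"
proof -
  let ?e = "\<lambda>v. ennreal (energy f (max 0 v))"
  have e[measurable]: "?e \<in> borel_measurable borel"
    using energy_measurable[OF f] by simp
  have fb: "f \<in> borel_measurable borel" using f by (auto simp: L2_iff)
  \<comment> \<open>The clamp changes nothing where the indicator is nonzero, and it gives joint
    measurability in time and space.\<close>
  have h_eq: "h z = indicator {0..t} (fst z) * transition P X (max 0 (t - fst z)) f (snd z)" for z
    by (auto simp: h_def indicator_def max_absorb2 split: prod.splits)
  have fst_m: "fst \<in> restrict_space lborel {0..} \<Otimes>\<^sub>M m \<rightarrow>\<^sub>M (borel :: real measure)"
    by (rule measurable_compose[OF measurable_fst measurable_restrict_space1]) simp
  have snd_m: "snd \<in> restrict_space (lborel :: real measure) {0..} \<Otimes>\<^sub>M m \<rightarrow>\<^sub>M borel"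
    using measurable_snd by (simp add: measurable_cong_sets[OF refl sets_m])
  have "(\<lambda>z. (t - fst z, snd z)) \<in> restrict_space lborel {0..} \<Otimes>\<^sub>M m \<rightarrow>\<^sub>M borel \<Otimes>\<^sub>M borel"
    by (intro measurable_Pair borel_measurable_diff borel_measurable_const fst_m snd_m)
  from measurable_compose[OF this transition_measurable_pair[OF fb]]
  have "(\<lambda>z. transition P X (max 0 (t - fst z)) f (snd z)) \<in> borel_measurable (space_time m)"
    by (simp add: space_time_def)
  moreover have "(\<lambda>z. indicator {0..t} (fst z) :: real) \<in> borel_measurable (space_time m)"
    unfolding space_time_def by (rule measurable_compose[OF fst_m]) auto
  ultimately have hm: "h \<in> borel_measurable (space_time m)"
    unfolding h_eq[abs_def] by (rule borel_measurable_times[rotated])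
  then have hm2: "(\<lambda>z. ennreal ((h z)\<^sup>2)) \<in> borel_measurable (restrict_space lborel {0..} \<Otimes>\<^sub>M m)"
    unfolding space_time_def by simp
  have "(\<integral>\<^sup>+z. ennreal ((h z)\<^sup>2) \<partial>space_time m)
      = (\<integral>\<^sup>+s. \<integral>\<^sup>+x. ennreal ((h (s, x))\<^sup>2) \<partial>m \<partial>restrict_space lborel {0..})"
    unfolding space_time_def by (rule nn_integral_fst[OF hm2, symmetric])
  also have "\<dots> = (\<integral>\<^sup>+s. indicator {0..t} s * ?e (t - s) \<partial>restrict_space lborel {0..})"
  proof (rule nn_integral_cong)
    fix s :: real
    show "(\<integral>\<^sup>+x. ennreal ((h (s, x))\<^sup>2) \<partial>m) = indicator {0..t} s * ?e (t - s)"
      using f by (cases "s \<in> {0..t}") (auto simp: h_eq ennreal_energy)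
  qed
  also have "\<dots> = (\<integral>\<^sup>+s. indicator {0..t} s * ?e (t - s) \<partial>lborel)"
    by (subst nn_integral_restrict_space) (auto intro!: nn_integral_cong simp: indicator_def)
  also have "\<dots> = (\<integral>\<^sup>+v. indicator {0..t} v * ?e v \<partial>lborel)"
  proof -
    have "indicator {0..t} (t - s) = (indicator {0..t} s :: ennreal)" for s
      by (auto simp: indicator_def)
    then show ?thesis
      using nn_integral_real_affine[of "\<lambda>v. indicator {0..t} v * ?e v" "-1" t] by simp
  qed
  finally show ?E .
  have "(\<integral>\<^sup>+v. indicator {0..t} v * ?e v \<partial>lborel)
      \<le> (\<integral>\<^sup>+v. (\<integral>\<^sup>+x. ennreal ((f x)\<^sup>2) \<partial>m) * indicator {0..t} v \<partial>lborel)"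
    using f by (intro nn_integral_mono) (auto simp: indicator_def intro!: energy_le_norm)
  also have "\<dots> < \<infinity>"
    using f t by (simp add: nn_integral_cmult_indicator L2_iff ennreal_mult_less_top)
  finally show "h \<in> L2 (space_time m)"
    using \<open>?E\<close> hm by (simp add: L2_iff)
qed

text \<open>The square of a time integral is an integral over the plane of the product of two values
  of the path; exchanging it with the integral over \<open>law\<close> leaves correlations, which
  are energies.\<close>

lemma expectation_from_occupation_square:
  assumes t: "0 \<le> t" and f: "f \<in> L2 m"
  shows "expectation_from P m (\<lambda>\<omega>. ennreal (\<bar>occupation X t f \<omega>\<bar>\<^sup>2)) =
    (\<integral>\<^sup>+s. \<integral>\<^sup>+r. indicator {0..t} s * indicator {0..t} r * ennreal (energy f (max 0 (\<bar>s - r\<bar> / 2))) \<partial>lborel \<partial>lborel)"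
proof -
  interpret PQ: pair_sigma_finite law "lborel :: (real \<times> real) measure"
    by (intro pair_sigma_finite.intro sigma_finite_law lborel.sigma_finite_measure_axioms)
  define Y where "Y s \<omega> = indicator {0..t} s * f (X (max 0 s) \<omega>)" for s \<omega>
  define Z where "Z \<omega> = (\<integral>s. Y s \<omega> \<partial>lborel)" for \<omega>
  define G where "G \<omega> p = Y (fst p) \<omega> * Y (snd p) \<omega>" for \<omega> p
  define c where "c = (\<integral>\<^sup>+x. ennreal ((f x)\<^sup>2) \<partial>m)"
  have c: "c < \<infinity>" using f by (simp add: c_def L2_iff)
  have fb[measurable]: "f \<in> borel_measurable borel" using f by (auto simp: L2_iff)
  have fX: "(\<lambda>z. f (X (max 0 (fst z)) (snd z))) \<in> borel_measurable (borel \<Otimes>\<^sub>M \<Omega>)"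
    using measurable_compose[OF X_measurable_pair fb] by (simp add: case_prod_beta')
  have Ym: "(\<lambda>z. Y (fst z) (snd z)) \<in> borel_measurable (borel \<Otimes>\<^sub>M \<Omega>)"
    unfolding Y_def by (intro borel_measurable_times fX) measurable
  have occ: "occupation X t f \<omega> = Z \<omega>" for \<omega>
    unfolding occupation_def set_lebesgue_integral_def Z_def Y_def
    by (intro Bochner_Integration.integral_cong) (auto simp: indicator_def max_absorb2)
  have "(\<lambda>z. (snd z, fst z)) \<in> \<Omega> \<Otimes>\<^sub>M lborel \<rightarrow>\<^sub>M (borel :: real measure) \<Otimes>\<^sub>M \<Omega>"
    by measurable
  from measurable_compose[OF this Ym]
  have Zm[measurable]: "Z \<in> borel_measurable \<Omega>"
    unfolding Z_def by (intro lborel.borel_measurable_lebesgue_integral) (simp add: case_prod_beta')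
  have Gm: "(\<lambda>z. G (fst z) (snd z)) \<in> borel_measurable (law \<Otimes>\<^sub>M lborel)"
  proof -
    have coord: "fst \<in> (lborel :: (real \<times> real) measure) \<rightarrow>\<^sub>M borel"
      "snd \<in> (lborel :: (real \<times> real) measure) \<rightarrow>\<^sub>M borel"
      by (simp_all add: borel_measurable_continuous_onI continuous_on_fst continuous_on_snd)
    have fstQ: "fst \<in> law \<Otimes>\<^sub>M (lborel :: (real \<times> real) measure) \<rightarrow>\<^sub>M \<Omega>"
      using measurable_fst[of law] by (simp add: measurable_cong_sets[OF refl sets_law])
    have "(\<lambda>z. (fst (snd z), fst z)) \<in> law \<Otimes>\<^sub>M (lborel :: (real \<times> real) measure) \<rightarrow>\<^sub>M borel \<Otimes>\<^sub>M \<Omega>"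
      "(\<lambda>z. (snd (snd z), fst z)) \<in> law \<Otimes>\<^sub>M (lborel :: (real \<times> real) measure) \<rightarrow>\<^sub>M borel \<Otimes>\<^sub>M \<Omega>"
      by (intro measurable_Pair fstQ measurable_compose[OF measurable_snd coord(1)]
          measurable_compose[OF measurable_snd coord(2)])+
    from measurable_compose[OF this(1) Ym] measurable_compose[OF this(2) Ym]
    show ?thesis unfolding G_def by simp
  qed
  \<comment> \<open>Absolute integrability for Fubini: a product is bounded by the sum of the
    squares, each of which has integral \<open>c\<close> by stationarity, and the square of side
    \<open>t\<close> has finite area.\<close>
  have G_bound: "(\<integral>\<^sup>+\<omega>. ennreal \<bar>G \<omega> p\<bar> \<partial>law) \<le> (c + c) * indicator ({0..t} \<times> {0..t}) p" for p
  proof (cases "p \<in> {0..t} \<times> {0..t}")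
    case True
    then obtain s r where p: "p = (s, r)" "s \<in> {0..t}" "r \<in> {0..t}" by auto
    have [measurable]: "X s \<in> \<Omega> \<rightarrow>\<^sub>M borel" "X r \<in> \<Omega> \<rightarrow>\<^sub>M borel"
      using p by (auto intro: X_measurable)
    have "(\<integral>\<^sup>+\<omega>. ennreal \<bar>G \<omega> p\<bar> \<partial>law)
        \<le> (\<integral>\<^sup>+\<omega>. ennreal ((f (X s \<omega>))\<^sup>2) + ennreal ((f (X r \<omega>))\<^sup>2) \<partial>law)"
      using p by (intro nn_integral_mono)
        (auto simp: G_def Y_def max_absorb2 abs_mult_le_sum_squares simp flip: ennreal_plus intro!: ennreal_leI)
    also have "\<dots> = c + c"
      using p nn_integral_law_X[of s "\<lambda>x. ennreal ((f x)\<^sup>2)"] nn_integral_law_X[of r "\<lambda>x. ennreal ((f x)\<^sup>2)"]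
      by (subst nn_integral_add) (auto simp: c_def)
    finally show ?thesis using True by simp
  next
    case False
    then have "G \<omega> p = 0" for \<omega> by (cases p) (auto simp: G_def Y_def)
    then show ?thesis by simp
  qed
  have G_int: "integrable (law \<Otimes>\<^sub>M lborel) (\<lambda>z. G (fst z) (snd z))"
  proof (rule integrableI_bounded[OF Gm])
    have "(\<lambda>z. ennreal (norm (G (fst z) (snd z)))) \<in> borel_measurable (law \<Otimes>\<^sub>M lborel)"
      using Gm by simp
    from PQ.nn_integral_snd[OF this]
    have "(\<integral>\<^sup>+z. ennreal (norm (G (fst z) (snd z))) \<partial>(law \<Otimes>\<^sub>M lborel))
        = (\<integral>\<^sup>+p. \<integral>\<^sup>+\<omega>. ennreal \<bar>G \<omega> p\<bar> \<partial>law \<partial>lborel)" by simp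
    also have "\<dots> \<le> (\<integral>\<^sup>+p. (c + c) * indicator ({0..t} \<times> {0..t}) p \<partial>lborel)"
      by (rule nn_integral_mono) (rule G_bound)
    also have "\<dots> = (c + c) * emeasure lborel ({0..t} \<times> {0..t})"
      by (rule nn_integral_cmult_indicator) (auto intro!: borel_closed closed_Times)
    also have "\<dots> < \<infinity>"
      using c emeasure_bounded_finite[of "{0..t} \<times> {0..t}"]
      by (auto simp: ennreal_mult_less_top bounded_Times)
    finally show "(\<integral>\<^sup>+z. ennreal (norm (G (fst z) (snd z))) \<partial>(law \<Otimes>\<^sub>M lborel)) < \<infinity>" .
  qed
  then have G_int': "integrable (law \<Otimes>\<^sub>M lborel) (case_prod G)" by (simp add: case_prod_beta')
  have inner: "(\<integral>\<omega>. G \<omega> p \<partial>law)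
      = indicator {0..t} (fst p) * indicator {0..t} (snd p) * energy f (max 0 (\<bar>fst p - snd p\<bar> / 2))" for p
    using correlation_abs[of "snd p" "fst p" f] f
    by (cases "fst p \<in> {0..t} \<and> snd p \<in> {0..t}") (auto simp: G_def Y_def max_absorb2)
  \<comment> \<open>Fubini gives integrability of \<open>G \<omega>\<close> over the plane for
    almost every \<omega> only; for those the iterated integral factors into
    \<open>Z \<omega>\<close> times itself.\<close>
  have outer: "AE \<omega> in law. (\<integral>p. G \<omega> p \<partial>lborel) = (Z \<omega>)\<^sup>2"
    using PQ.AE_integrable_fst[OF G_int']
  proof eventually_elim
    case (elim \<omega>)
    then have "integrable (lborel \<Otimes>\<^sub>M lborel) (\<lambda>(s, r). G \<omega> (s, r))"
      by (simp add: lborel_prod)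
    from lborel_pair.integral_fst'[OF this]
    have "(\<integral>p. G \<omega> p \<partial>lborel) = (\<integral>s. \<integral>r. G \<omega> (s, r) \<partial>lborel \<partial>lborel)"
      by (simp add: lborel_prod)
    then show ?case
      by (simp add: G_def Z_def power2_eq_square)
  qed
  have "expectation_from P m (\<lambda>\<omega>. ennreal (\<bar>occupation X t f \<omega>\<bar>\<^sup>2)) = (\<integral>\<^sup>+\<omega>. ennreal ((Z \<omega>)\<^sup>2) \<partial>law)"
    unfolding expectation_from_def occ by (subst nn_integral_law) auto
  also have "\<dots> = (\<integral>\<^sup>+\<omega>. ennreal (\<integral>p. G \<omega> p \<partial>lborel) \<partial>law)"
    by (rule nn_integral_cong_AE) (use outer in eventually_elim, simp)
  \<comment> \<open>\<open>G\<close> changes sign, so the exchange is made with Bochner integrals.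
    Both partial integrals are nonnegative, one being a square and the other an energy on the square
    of side \<open>t\<close>, which allows the passage from \<open>ennreal\<close> and back.\<close>
  also have "\<dots> = ennreal (\<integral>\<omega>. \<integral>p. G \<omega> p \<partial>lborel \<partial>law)"
  proof (rule nn_integral_eq_integral)
    show "integrable law (\<lambda>\<omega>. \<integral>p. G \<omega> p \<partial>lborel)"
      using PQ.integrable_fst'[OF G_int] by simp
    show "AE \<omega> in law. 0 \<le> (\<integral>p. G \<omega> p \<partial>lborel)"
      using outer by eventually_elim simp
  qed
  also have "(\<integral>\<omega>. \<integral>p. G \<omega> p \<partial>lborel \<partial>law) = (\<integral>p. \<integral>\<omega>. G \<omega> p \<partial>law \<partial>lborel)"
    by (rule PQ.Fubini_integral[OF G_int', symmetric])
  also have "ennreal \<dots> = (\<integral>\<^sup>+p. ennreal (\<integral>\<omega>. G \<omega> p \<partial>law) \<partial>lborel)"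
  proof (rule nn_integral_eq_integral[symmetric])
    show "integrable lborel (\<lambda>p. \<integral>\<omega>. G \<omega> p \<partial>law)"
      by (rule PQ.integrable_snd[OF G_int'])
    show "AE p in lborel. 0 \<le> (\<integral>\<omega>. G \<omega> p \<partial>law)"
      by (auto simp: inner energy_nonneg)
  qed
  also have "\<dots> = (\<integral>\<^sup>+p. indicator {0..t} (fst p) * indicator {0..t} (snd p)
      * ennreal (energy f (max 0 (\<bar>fst p - snd p\<bar> / 2))) \<partial>(lborel \<Otimes>\<^sub>M lborel))"
    unfolding inner lborel_prod
    by (intro nn_integral_cong) (auto simp: indicator_def)
  also have "\<dots> = (\<integral>\<^sup>+s. \<integral>\<^sup>+r. indicator {0..t} s * indicator {0..t} r
      * ennreal (energy f (max 0 (\<bar>s - r\<bar> / 2))) \<partial>lborel \<partial>lborel)"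
  proof -
    have [measurable]: "(\<lambda>p. energy f (max 0 (\<bar>fst p - snd p\<bar> / 2)))
        \<in> borel_measurable ((lborel :: real measure) \<Otimes>\<^sub>M lborel)"
      by (rule measurable_compose[OF _ energy_measurable[OF f]]) measurable
    have "(\<lambda>p. indicator {0..t} (fst p) * indicator {0..t} (snd p)
        * ennreal (energy f (max 0 (\<bar>fst p - snd p\<bar> / 2)))) \<in> borel_measurable (lborel \<Otimes>\<^sub>M lborel)"
      by measurable
    from lborel.nn_integral_fst[OF this] show ?thesis by simp
  qed
  finally show ?thesis .
qed

lemma occupation_bounds:
  assumes t: "0 \<le> t" and f: "f \<in> L2 m"
    and w: "white_noise N (space_time m) w"
  shows "ennreal (t / 2) * (\<integral>\<^sup>+\<omega>. ennreal ((weak_solution P X m N w t f \<omega>)\<^sup>2) \<partial>N)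
      \<le> expectation_from P m (\<lambda>\<omega>. ennreal (\<bar>occupation X t f \<omega>\<bar>\<^sup>2))"
    and "expectation_from P m (\<lambda>\<omega>. ennreal (\<bar>occupation X t f \<omega>\<bar>\<^sup>2))
      \<le> ennreal (4 * t) * (\<integral>\<^sup>+\<omega>. ennreal ((weak_solution P X m N w t f \<omega>)\<^sup>2) \<partial>N)"
proof -
  interpret white_noise N "space_time m" w by (rule w)
  let ?e = "\<lambda>v. ennreal (energy f (max 0 v))"
  have e: "?e \<in> borel_measurable borel"
    using energy_measurable[OF f] by simp
  \<comment> \<open>The clamp makes \<open>?e\<close> constant on negative arguments, hence antimono
    on the whole line, as the lower bound requires.\<close>
  have "antimono ?e"
    using f by (auto simp: antimono_def intro!: ennreal_leI energy_antimono)
  have u: "(\<integral>\<^sup>+\<omega>. ennreal ((weak_solution P X m N w t f \<omega>)\<^sup>2) \<partial>N)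
      = (\<integral>\<^sup>+v. indicator {0..t} v * ?e v \<partial>lborel)"
    unfolding weak_solution_def weak_solution_integrand(1)[OF t f, symmetric]
    by (rule wiener_integral_norm[OF weak_solution_integrand(2)[OF t f]])
  show "ennreal (t / 2) * (\<integral>\<^sup>+\<omega>. ennreal ((weak_solution P X m N w t f \<omega>)\<^sup>2) \<partial>N)
      \<le> expectation_from P m (\<lambda>\<omega>. ennreal (\<bar>occupation X t f \<omega>\<bar>\<^sup>2))"
    unfolding u expectation_from_occupation_square[OF t f]
    by (rule nn_integral_abs_diff_lower[OF e t \<open>antimono ?e\<close>])
  show "expectation_from P m (\<lambda>\<omega>. ennreal (\<bar>occupation X t f \<omega>\<bar>\<^sup>2))
      \<le> ennreal (4 * t) * (\<integral>\<^sup>+\<omega>. ennreal ((weak_solution P X m N w t f \<omega>)\<^sup>2) \<partial>N)"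
    unfolding u expectation_from_occupation_square[OF t f]
    by (rule nn_integral_abs_diff_upper[OF e t])
qed

end

theorem theorem7p2:
  fixes \<Omega> :: "'w measure"
    and P :: "'a::{metric_space, second_countable_topology} \<Rightarrow> 'w measure"
    and X :: "real \<Rightarrow> 'w \<Rightarrow> 'a"
    and m :: "'a measure"
    and N :: "'v measure"
    and w :: "(real \<times> 'a) set \<Rightarrow> 'v \<Rightarrow> real"
    and \<phi> :: "'a \<Rightarrow> real"
    and t :: real
  assumes "locally compact (UNIV :: 'a set)"
    and "markov_process \<Omega> P X"
    and "radon_measure m"
    and "symmetrizing P X m"
    and "white_noise N (space_time m) w"
    and "\<phi> \<in> L2 m"
    and "t \<ge> 0"
  shows "ennreal (1 / 8 * t) * (\<integral>\<^sup>+\<omega>. ennreal (\<bar>weak_solution P X m N w t \<phi> \<omega>\<bar>\<^sup>2) \<partial>N)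
           \<le> expectation_from P m (\<lambda>\<omega>. ennreal (\<bar>occupation X t \<phi> \<omega>\<bar>\<^sup>2)) \<and>
         expectation_from P m (\<lambda>\<omega>. ennreal (\<bar>occupation X t \<phi> \<omega>\<bar>\<^sup>2))
           \<le> ennreal (4 * t) * (\<integral>\<^sup>+\<omega>. ennreal (\<bar>weak_solution P X m N w t \<phi> \<omega>\<bar>\<^sup>2) \<partial>N)"
proof
  interpret symmetric_markov_process \<Omega> P X m
    using assms(1-4) radon_measure_sigma_finite[OF assms(1,3)]
    by (auto simp: symmetric_markov_process_def symmetric_markov_process_axioms_def radon_measure_def)
  let ?U = "\<integral>\<^sup>+\<omega>. ennreal ((weak_solution P X m N w t \<phi> \<omega>)\<^sup>2) \<partial>N"
  have "ennreal (1 / 8 * t) * ?U \<le> ennreal (t / 2) * ?U"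
    using assms(7) by (intro mult_right_mono ennreal_leI) auto
  also have "\<dots> \<le> expectation_from P m (\<lambda>\<omega>. ennreal (\<bar>occupation X t \<phi> \<omega>\<bar>\<^sup>2))"
    by (rule occupation_bounds(1)[OF assms(7,6,5)])
  finally show "ennreal (1 / 8 * t) * (\<integral>\<^sup>+\<omega>. ennreal (\<bar>weak_solution P X m N w t \<phi> \<omega>\<bar>\<^sup>2) \<partial>N)
      \<le> expectation_from P m (\<lambda>\<omega>. ennreal (\<bar>occupation X t \<phi> \<omega>\<bar>\<^sup>2))"
    by simp
  show "expectation_from P m (\<lambda>\<omega>. ennreal (\<bar>occupation X t \<phi> \<omega>\<bar>\<^sup>2))
      \<le> ennreal (4 * t) * (\<integral>\<^sup>+\<omega>. ennreal (\<bar>weak_solution P X m N w t \<phi> \<omega>\<bar>\<^sup>2) \<partial>N)"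
    using occupation_bounds(2)[OF assms(7,6,5)] by simp
qed

end
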